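(* Let $G=(V=V_1\sqcup V_2,E)$ be a turn-based game with $n$ vertices, let $r\colon E\to\mathbb{Z}$ be a reward function with $W=\max_{(v,u)\in E}|r(v,u)|$, and let $\lambda\in[0,1)$ be a discount factor. Then the strategy iteration algorithm (described in the context) computes an optimal player-1 strategy (and hence solves the value problem) after at most $n^{\mathcal{O}\left(W^{1/4}\sqrt{n}\right)}$ iterations, from any initial player-1 strategy.
   Context: A turn-based game $G=(V=V_1\sqcup V_2,E)$ is a finite directed graph whose vertex set $V$ ($|V|=n$) is partitioned into player-1 vertices $V_1$ and player-2 vertices $V_2$, and every vertex $v$ has a non-empty set of successors $E(v)=\{u:(v,u)\in E\}$. A play is an infinite sequence $\langle v_0,v_1,\dots\rangle$ with $v_{t+1}\in E(v_t)$. Given rewards $r\colon E\to\mathbb{Z}$ and $\lambda\in[0,1)$, the discounted payoff of a play is $\mathrm{Disc}_\lambda(\langle v_0,v_1,\dots\rangle)=\sum_{i\ge0}\lambda^i r(v_i,v_{i+1})$; player 1 maximizes and player 2 minimizes it. A positional strategy for player 1 (resp. 2) is a map $\sigma\colon V_1\to V$ (resp. $\tau\colon V_2\to V$) with $\sigma(v)\in E(v)$; a profile $(\sigma,\tau)$ and a start vertex $v$ determine a unique (lasso-shaped) play $G_v^{\sigma,\tau}$. The value of $v$ is $\mathrm{val}_\lambda(v)=\max_\sigma\min_\tau \mathrm{Disc}_\lambda(G_v^{\sigma,\tau})$ over positional strategies; $\sigma$ is optimal if $\min_\tau\mathrm{Disc}_\lambda(G_v^{\sigma,\tau})=\mathrm{val}_\lambda(v)$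 for all $v$. A best response to $\sigma$ is a player-2 strategy $\tau$ with $\mathrm{Disc}_\lambda(G_v^{\sigma,\tau})\le \mathrm{Disc}_\lambda(G_v^{\sigma,\tau'})$ for all $\tau'$ and all $v$. For $f\colon V\to\mathbb{R}$, the Bellman strategy extractor $\mathcal{B}_{G,\lambda}(f)$ picks at $v\in V_1$ an $\arg\max_{u\in E(v)} r(v,u)+\lambda f(u)$ and at $v\in V_2$ an $\arg\min_{u\in E(v)} r(v,u)+\lambda f(u)$, with ties resolved by a fixed rule independent of $\lambda$ (e.g. least index in a fixed vertex indexing). Strategy iteration: starting from an arbitrary player-1 strategy $\sigma^0$, at iteration $k$ compute a best response $\tau^k$ to $\sigma^k$, set $\sigma^{k+1}=\mathcal{B}_{G,\lambda}$ applied to the vector $v\mapsto \mathrm{Disc}_\lambda(G_v^{\sigma^k,\tau^k})$ (restricted to player-1 vertices), and stop when $\sigma^{k+1}=\sigma^k$, returning $\sigma^k$. *)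

theory Defs
  imports Complex_Main
begin

text \<open>A turn-based game on vertices 0..<n: player-1 vertices V1 (subset of {..<n}),
  player-2 vertices are the rest of {..<n}; edges E; rewards r (only values on E matter).\<close>

definition game :: "nat \<Rightarrow> nat set \<Rightarrow> (nat \<times> nat) set \<Rightarrow> bool" where
  "game n V1 E \<longleftrightarrow> V1 \<subseteq> {..<n} \<and> E \<subseteq> {..<n} \<times> {..<n}
     \<and> (\<forall>v<n. \<exists>u. (v, u) \<in> E)"

definition strat1 :: "nat \<Rightarrow> nat set \<Rightarrow> (nat \<times> nat) set \<Rightarrow> (nat \<Rightarrow> nat) set" where
  "strat1 n V1 E = {\<sigma>. \<forall>v\<in>V1. (v, \<sigma> v) \<in> E}"

definition strat2 :: "nat \<Rightarrow> nat set \<Rightarrow> (nat \<times> nat) set \<Rightarrow> (nat \<Rightarrow> nat) set" where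
  "strat2 n V1 E = {\<tau>. \<forall>v\<in>{..<n} - V1. (v, \<tau> v) \<in> E}"

definition play :: "nat set \<Rightarrow> (nat \<Rightarrow> nat) \<Rightarrow> (nat \<Rightarrow> nat) \<Rightarrow> nat \<Rightarrow> nat \<Rightarrow> nat" where
  "play V1 \<sigma> \<tau> v i = ((\<lambda>x. if x \<in> V1 then \<sigma> x else \<tau> x) ^^ i) v"

definition disc :: "nat set \<Rightarrow> (nat \<Rightarrow> nat \<Rightarrow> int) \<Rightarrow> real \<Rightarrow> (nat \<Rightarrow> nat) \<Rightarrow> (nat \<Rightarrow> nat) \<Rightarrow> nat \<Rightarrow> real" where
  "disc V1 r lam \<sigma> \<tau> v =
     (\<Sum>i. lam ^ i * real_of_int (r (play V1 \<sigma> \<tau> v i) (play V1 \<sigma> \<tau> v (Suc i))))"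

definition val :: "nat \<Rightarrow> nat set \<Rightarrow> (nat \<times> nat) set \<Rightarrow> (nat \<Rightarrow> nat \<Rightarrow> int) \<Rightarrow> real \<Rightarrow> nat \<Rightarrow> real" where
  "val n V1 E r lam v =
     (SUP \<sigma>\<in>strat1 n V1 E. INF \<tau>\<in>strat2 n V1 E. disc V1 r lam \<sigma> \<tau> v)"

definition optimal1 :: "nat \<Rightarrow> nat set \<Rightarrow> (nat \<times> nat) set \<Rightarrow> (nat \<Rightarrow> nat \<Rightarrow> int) \<Rightarrow> real \<Rightarrow> (nat \<Rightarrow> nat) \<Rightarrow> bool" where
  "optimal1 n V1 E r lam \<sigma> \<longleftrightarrow> \<sigma> \<in> strat1 n V1 E \<and>
     (\<forall>v<n. (INF \<tau>\<in>strat2 n V1 E. disc V1 r lam \<sigma> \<tau> v) = val n V1 E r lam v)"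

definition best_response :: "nat \<Rightarrow> nat set \<Rightarrow> (nat \<times> nat) set \<Rightarrow> (nat \<Rightarrow> nat \<Rightarrow> int) \<Rightarrow> real \<Rightarrow> (nat \<Rightarrow> nat) \<Rightarrow> (nat \<Rightarrow> nat) \<Rightarrow> bool" where
  "best_response n V1 E r lam \<sigma> \<tau> \<longleftrightarrow> \<tau> \<in> strat2 n V1 E \<and>
     (\<forall>\<tau>'\<in>strat2 n V1 E. \<forall>v<n. disc V1 r lam \<sigma> \<tau> v \<le> disc V1 r lam \<sigma> \<tau>' v)"

definition bellman1 :: "(nat \<times> nat) set \<Rightarrow> (nat \<Rightarrow> nat \<Rightarrow> int) \<Rightarrow> real \<Rightarrow> (nat \<Rightarrow> real) \<Rightarrow> nat \<Rightarrow> nat" where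
  "bellman1 E r lam f v = (LEAST u. (v, u) \<in> E \<and>
     (\<forall>u'. (v, u') \<in> E \<longrightarrow> real_of_int (r v u') + lam * f u' \<le> real_of_int (r v u) + lam * f u))"

definition maxabs_reward :: "(nat \<times> nat) set \<Rightarrow> (nat \<Rightarrow> nat \<Rightarrow> int) \<Rightarrow> real" where
  "maxabs_reward E r = real_of_int (Max ((\<lambda>(v, u). \<bar>r v u\<bar>) ` E))"

definition SI_run :: "nat \<Rightarrow> nat set \<Rightarrow> (nat \<times> nat) set \<Rightarrow> (nat \<Rightarrow> nat \<Rightarrow> int) \<Rightarrow> real
     \<Rightarrow> (nat \<Rightarrow> nat \<Rightarrow> nat) \<Rightarrow> (nat \<Rightarrow> nat \<Rightarrow> nat) \<Rightarrow> bool" where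
  "SI_run n V1 E r lam \<sigma> \<tau> \<longleftrightarrow> \<sigma> 0 \<in> strat1 n V1 E \<and>
     (\<forall>k. best_response n V1 E r lam (\<sigma> k) (\<tau> k)) \<and>
     (\<forall>k. \<forall>v\<in>V1. \<sigma> (Suc k) v = bellman1 E r lam (disc V1 r lam (\<sigma> k) (\<tau> k)) v)"

definition SI_stops_at :: "nat set \<Rightarrow> (nat \<Rightarrow> nat \<Rightarrow> nat) \<Rightarrow> nat \<Rightarrow> bool" where
  "SI_stops_at V1 \<sigma> k \<longleftrightarrow> (\<forall>v\<in>V1. \<sigma> (Suc k) v = \<sigma> k v)"

end

theory Submission
  imports Defs "HOL-Computational_Algebra.Polynomial" "HOL-Library.FuncSet"
begin

text \<open>For a fixed discount factor \<open>x\<close>, strategy iteration stops after a number of iterations that is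
  polynomial in \<open>n\<close> and \<open>1 / (1 - x)\<close>. All decisions made during a run compare discounted payoffs of
  lassos, hence evaluate the sign of an integer polynomial of degree \<open>O(n)\<close> and height \<open>O(W)\<close>. Such a
  polynomial vanishes at 1 to order \<open>O(W powr (1/4) * sqrt n)\<close> only, and therefore has constant sign on an
  interval left of 1 of length \<open>n powr - O(W powr (1/4) * sqrt n)\<close>. A run for a discount factor in
  that interval is thus also a run for a discount factor that is not too close to 1.\<close>

text \<open>The exponent balances a kernel estimate. A test polynomial of degree
  \<open>2 * (m - 1)\<close> can have value \<open>m ^ 4\<close> at 0 while its values at 1, ..., N
  - 1, weighted by coefficients of size H, add up to less than 2 H N^2. With H of order W and N of
  order n, a zero of order \<open>2 * m - 1\<close> at 1 is excluded once m is of order W^(1/4) sqrt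
  n. The transfer between discount factors must preserve ties as well as strict inequalities,
  because the Bellman step picks the least maximiser; hence signs are compared with 0 included. It
  keeps the given sequences \<open>\<sigma>\<close> and \<open>\<tau>\<close>, whatever rule selects
  the best responses. The threshold is X = 16 W (3n)^(2m): if 1 / (1 - lam) exceeds X, the run is
  viewed at 1 - 1 / X instead.\<close>

subsection \<open>Integer polynomials near 1\<close>

text \<open>\<open>fejer_poly m\<close> is \<open>(1 - T y) / (1 - y)\<close> for the Chebyshev polynomial \<open>T\<close> of degree \<open>m\<close>.\<close>
fun fejer_poly :: "nat \<Rightarrow> real poly" where
  "fejer_poly 0 = 0"
| "fejer_poly (Suc 0) = 1"
| "fejer_poly (Suc (Suc m)) = [:0, 2:] * fejer_poly (Suc m) - fejer_poly m + [:2:]"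

text \<open>The additive \<open>2\<close> in the recursion contributes
  \<open>2 * (1 - cos t)\<close>, exactly what carries the Chebyshev recurrence over from
  \<open>cos (real m * t)\<close> to \<open>1 - cos (real m * t)\<close>.\<close>

lemma fejer_poly_cos: "(1 - cos t) * poly (fejer_poly m) (cos t) = 1 - cos (real m * t)"
proof (induction m rule: fejer_poly.induct)
  case (3 m)
  have "cos (real (Suc (Suc m)) * t) + cos (real m * t) = 2 * cos t * cos (real (Suc m) * t)"
  proof -
    have "cos (real (Suc m) * t + t) + cos (real (Suc m) * t - t) = 2 * cos t * cos (real (Suc m) * t)"
      by (simp only: cos_add cos_diff) simp
    moreover have "real (Suc m) * t + t = real (Suc (Suc m)) * t" "real (Suc m) * t - t = real m * t"
      by (simp_all add: algebra_simps)
    ultimately show ?thesis by simp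
  qed
  moreover have "(1 - cos t) * poly (fejer_poly (Suc (Suc m))) (cos t)
     = 2 * cos t * ((1 - cos t) * poly (fejer_poly (Suc m)) (cos t))
       - (1 - cos t) * poly (fejer_poly m) (cos t) + 2 * (1 - cos t)"
    by (simp add: algebra_simps)
  ultimately show ?case using 3 by (simp only: right_diff_distrib)
qed auto

text \<open>At 1 the cosine identity degenerates to 0 = 0, so the peak value is read off the
  recursion.\<close>

lemma fejer_poly_at_1: "poly (fejer_poly m) 1 = (real m)\<^sup>2"
  by (induction m rule: fejer_poly.induct) (auto simp: power2_eq_square algebra_simps)

lemma degree_fejer_poly: "degree (fejer_poly m) \<le> m - 1"
proof (induction m rule: fejer_poly.induct)
  case (3 m)
  have "degree ([:0, 2:] * fejer_poly (Suc m)) \<le> Suc m"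
    using degree_mult_le[of "[:0, 2:]" "fejer_poly (Suc m)"] 3 by simp
  moreover have "degree (fejer_poly m) \<le> Suc m" using 3 by simp
  ultimately have "degree ([:0, 2:] * fejer_poly (Suc m) - fejer_poly m) \<le> Suc m"
    by (rule degree_diff_le)
  thus ?case by (auto intro!: degree_add_le simp del: mult_pCons_left)
qed auto

lemma fejer_poly_bound:
  assumes "-1 \<le> y" "y < 1"
  shows "\<bar>poly (fejer_poly m) y\<bar> \<le> 2 / (1 - y)"
proof -
  have "(1 - y) * poly (fejer_poly m) y = 1 - cos (real m * arccos y)"
    using fejer_poly_cos[of "arccos y" m] assms by (simp add: cos_arccos)
  moreover have "\<bar>1 - cos (real m * arccos y)\<bar> \<le> 2"
    using cos_le_one[of "real m * arccos y"] cos_ge_minus_one[of "real m * arccos y"]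
    unfolding abs_le_iff by linarith
  ultimately have "(1 - y) * \<bar>poly (fejer_poly m) y\<bar> \<le> 2"
    using assms by (metis abs_mult abs_of_pos diff_gt_0_iff_gt)
  thus ?thesis using assms by (simp add: pos_le_divide_eq mult.commute)
qed

section \<open>Order of vanishing at 1\<close>

text \<open>Each Euler derivative costs at most one factor \<open>x - 1\<close>, so a zero of order
  \<open>k\<close> at 1 allows tests against all polynomials of degree below
  \<open>k\<close>.\<close>

lemma dvd_euler_derivative:
  fixes p :: "real poly"
  assumes "[:-1, 1:] ^ Suc k dvd p"
  shows "[:-1, 1:] ^ k dvd pCons 0 (pderiv p)"
proof -
  obtain q where q: "p = [:-1, 1:] ^ Suc k * q" using assms by blast
  have "[:-1, 1:] ^ k dvd pderiv p"
    unfolding q pderiv_mult pderiv_power_Suc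
    by (metis dvd_add dvd_mult dvd_mult2 dvd_refl dvd_smult power_Suc)
  hence "[:-1, 1:] ^ k dvd [:0, 1:] * pderiv p" by (rule dvd_mult)
  thus ?thesis by simp
qed

text \<open>With the Euler derivative \<open>x p'\<close> in place of \<open>p\<close>, the coefficients get
  multiplied by their index.\<close>
lemma moments_vanish:
  fixes p Q :: "real poly"
  assumes "[:-1, 1:] ^ k dvd p" "degree Q < k" "degree p < N"
  shows "(\<Sum>j<N. coeff p j * poly Q (real j)) = 0"
  using assms
proof (induction Q arbitrary: p k rule: pCons_induct)
  case 0
  thus ?case by simp
next
  case (pCons a Q)
  obtain k' where k: "k = Suc k'" using pCons.prems by (cases k) auto
  have "poly p 1 = 0"
    using dvd_trans[OF dvd_power[of k "[:-1, 1:]"] pCons.prems(1)] k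
    by (simp add: poly_eq_0_iff_dvd)
  moreover have "poly p 1 = (\<Sum>j<N. coeff p j)"
  proof -
    have "poly p 1 = (\<Sum>j\<le>degree p. coeff p j)" by (simp add: poly_altdef)
    also have "\<dots> = (\<Sum>j<N. coeff p j)"
      using pCons.prems by (intro sum.mono_neutral_left) (auto simp: coeff_eq_0)
    finally show ?thesis .
  qed
  ultimately have 1: "(\<Sum>j<N. coeff p j) = 0" by simp
  have 2: "(\<Sum>j<N. coeff p j * (real j * poly Q (real j))) = 0"
  \<comment> \<open>For \<open>Q = 0\<close> the number \<open>k'\<close> may be 0, which puts the
    induction hypothesis out of reach.\<close>
  proof (cases "Q = 0")
    case False
    have "degree (pCons 0 (pderiv p)) < N"
      using pCons.prems by (auto simp: degree_pCons_eq_if degree_pderiv pderiv_eq_0_iff)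
    moreover have "degree Q < k'" using pCons.prems k False by simp
    ultimately have "(\<Sum>j<N. coeff (pCons 0 (pderiv p)) j * poly Q (real j)) = 0"
      using pCons.IH dvd_euler_derivative pCons.prems(1) k by blast
    moreover have "coeff (pCons 0 (pderiv p)) j = coeff p j * real j" for j
      by (cases j) (auto simp: coeff_pderiv)
    ultimately show ?thesis by (simp add: mult.assoc)
  qed simp
  have "(\<Sum>j<N. coeff p j * poly (pCons a Q) (real j))
      = a * (\<Sum>j<N. coeff p j) + (\<Sum>j<N. coeff p j * (real j * poly Q (real j)))"
    by (simp add: algebra_simps sum.distrib sum_distrib_left)
  thus ?case using 1 2 by simp
qed


text \<open>A telescoping bound; the subtracted term drives the induction and later keeps the sum
  strictly below 2.\<close>

lemma sum_inverse_squares_le: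
  assumes "0 < n"
  shows "(\<Sum>j=1..n. 1 / (real j)\<^sup>2) \<le> 2 - 1 / real n"
  using assms
proof (induction n rule: nat_induct_non_zero)
  case (Suc n)
  have "1 / (real (Suc n))\<^sup>2 \<le> 1 / (real n * real (Suc n))"
    using Suc by (intro divide_left_mono) (auto simp: power2_eq_square)
  also have "\<dots> = 1 / real n - 1 / real (Suc n)"
    using Suc by (simp add: field_simps)
  finally show ?case using Suc by simp
qed simp

text \<open>The polynomial \<open>Q\<close> below is a squared Fejer kernel, so that \<open>Q j\<close> decays like \<open>1 / j\<^sup>2\<close>
  and the term \<open>j = 0\<close> would dominate the vanishing sum of \<open>coeff p j * Q j\<close>.\<close>
lemma vanishing_order_at_1_less:
  fixes p :: "real poly" and H :: real
  assumes dvd: "[:-1, 1:] ^ k dvd p" and deg: "degree p < N"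
    and c0: "1 \<le> \<bar>coeff p 0\<bar>" and H: "\<And>j. \<bar>coeff p j\<bar> \<le> H"
    and m: "0 < m" "2 * H * (real N)\<^sup>2 \<le> real m ^ 4"
  shows "k < 2 * m - 1"
proof (rule ccontr)
  assume "\<not> ?thesis"
  hence km: "2 * (m - 1) < k" using m by simp
  have N: "0 < N" using deg by simp
  \<comment> \<open>The substitution sends 0 to 1, the peak of the Fejer polynomial, and 1, ..., N -
    1 into (-1, 1), where the bound 2 / (1 - y) applies.\<close>
  define F where "F = pcompose (fejer_poly m) [:1, - 2 / real N:]"
  define Q where "Q = F\<^sup>2"
  have "degree F \<le> m - 1"
    unfolding F_def using degree_pcompose_le[of "fejer_poly m" "[:1, - 2 / real N:]"]
      degree_fejer_poly[of m] N by simp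
  hence "degree Q < k"
    unfolding Q_def power2_eq_square using degree_mult_le[of F F] km by linarith
  hence zero: "(\<Sum>j<N. coeff p j * poly Q (real j)) = 0"
    using moments_vanish[OF dvd _ deg] by blast
  have Q0: "poly Q 0 = real m ^ 4"
    by (simp add: Q_def F_def poly_pcompose fejer_poly_at_1)
  have Qj: "\<bar>poly Q (real j)\<bar> \<le> (real N)\<^sup>2 * (1 / (real j)\<^sup>2)" if "1 \<le> j" "j < N" for j
  proof -
    have "\<bar>poly F (real j)\<bar> \<le> 2 / (1 - (1 - 2 * real j / real N))"
      unfolding F_def poly_pcompose
      using fejer_poly_bound[of "1 - 2 * real j / real N" m] that by (simp add: field_simps)
    also have "\<dots> = real N / real j" using that by simp
    finally have "\<bar>poly F (real j)\<bar>\<^sup>2 \<le> (real N / real j)\<^sup>2"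
      by (intro power_mono) auto
    thus ?thesis by (simp add: Q_def power_divide)
  qed
  have H0: "0 < H" using c0 H[of 0] by linarith
  have split: "{..<N} = insert 0 {1..N - 1}" using N by auto
  have "real m ^ 4 \<le> \<bar>coeff p 0\<bar> * real m ^ 4" using mult_right_mono[OF c0, of "real m ^ 4"] by simp
  also have "\<dots> = \<bar>coeff p 0 * poly Q 0\<bar>" by (simp add: Q0 abs_mult)
  also have "\<dots> = \<bar>\<Sum>j=1..N - 1. coeff p j * poly Q (real j)\<bar>"
    using zero unfolding split by simp
  also have "\<dots> \<le> (\<Sum>j=1..N - 1. \<bar>coeff p j * poly Q (real j)\<bar>)" by (rule sum_abs)
  also have "\<dots> \<le> (\<Sum>j=1..N - 1. H * ((real N)\<^sup>2 * (1 / (real j)\<^sup>2)))"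
    using N unfolding abs_mult by (intro sum_mono mult_mono H Qj order.strict_implies_order[OF H0]) auto
  also have "\<dots> = H * (real N)\<^sup>2 * (\<Sum>j=1..N - 1. 1 / (real j)\<^sup>2)"
    by (simp add: sum_distrib_left)
  also have "\<dots> < H * (real N)\<^sup>2 * 2"
  proof (rule mult_strict_left_mono)
    show "(\<Sum>j=1..N - 1. 1 / (real j)\<^sup>2) < 2"
    proof (cases "N = 1")
      case False
      hence "0 < 1 / real (N - 1)" using N by simp
      thus ?thesis using sum_inverse_squares_le[of "N - 1"] N False by linarith
    qed simp
  qed (use H0 N in auto)
  finally show False using m(2) by simp
qed

text \<open>The coefficients of \<open>q\<close> are the negated partial sums of those of
  \<open>[:-1, 1:] * q\<close>: at most \<open>N\<close> summands, all integers of size at most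
  \<open>H\<close>.\<close>

lemma factor_out_bound:
  fixes q :: "real poly"
  assumes H: "\<And>j. \<bar>coeff ([:-1, 1:] * q) j\<bar> \<le> H" and deg: "degree ([:-1, 1:] * q) < N"
    and int: "\<And>j. coeff ([:-1, 1:] * q) j \<in> \<int>"
  shows "\<bar>coeff q j\<bar> \<le> real N * H" "coeff q j \<in> \<int>"
proof -
  have rec0: "coeff q 0 = - coeff ([:-1, 1:] * q) 0" by simp
  have rec: "coeff q (Suc i) = coeff q i - coeff ([:-1, 1:] * q) (Suc i)" for i by simp
  have H0: "0 \<le> H" using H[of 0] by linarith
  have bound: "\<bar>coeff q i\<bar> \<le> real (Suc i) * H" for i
  proof (induction i)
    case 0
    show ?case using H[of 0] by simp
  next
    case (Suc i)
    have "\<bar>coeff q (Suc i)\<bar> \<le> \<bar>coeff q i\<bar> + \<bar>coeff ([:-1, 1:] * q) (Suc i)\<bar>"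
      unfolding rec by linarith
    thus ?case using Suc H[of "Suc i"] by (simp add: algebra_simps)
  qed
  show "\<bar>coeff q j\<bar> \<le> real N * H"
  proof (cases "j \<le> degree q \<and> q \<noteq> 0")
    case True
    hence "Suc j \<le> N" using deg degree_mult_eq[of "[:-1, 1:]" q] by simp
    hence "real (Suc j) * H \<le> real N * H" using H0 by (intro mult_right_mono) auto
    thus ?thesis using bound[of j] by linarith
  next
    case False
    thus ?thesis using H0 by (auto simp: coeff_eq_0)
  qed
  show "coeff q j \<in> \<int>"
  proof (induction j)
    case 0
    show ?case unfolding rec0 using int by (intro Ints_minus)
  next
    case (Suc j)
    thus ?case unfolding rec using int by (intro Ints_diff)
  qed
qed

lemma factor_out_power_bound:
  fixes q :: "real poly"
  assumes "\<And>j. \<bar>coeff ([:-1, 1:] ^ k * q) j\<bar> \<le> H" "degree ([:-1, 1:] ^ k * q) < N"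
    "\<And>j. coeff ([:-1, 1:] ^ k * q) j \<in> \<int>"
  shows "(\<forall>j. \<bar>coeff q j\<bar> \<le> real N ^ k * H \<and> coeff q j \<in> \<int>) \<and> degree q < N"
  using assms
proof (induction k arbitrary: H)
  case (Suc k)
  define q' where "q' = [:-1, 1:] ^ k * q"
  have eq: "[:-1, 1:] ^ Suc k * q = [:-1, 1:] * q'" by (simp only: q'_def power_Suc mult.assoc)
  note b = factor_out_bound[OF Suc.prems[unfolded eq]]
  have "degree q' < N"
    using Suc.prems(2) degree_mult_eq[of "[:-1, 1:]" q'] unfolding eq by (cases "q' = 0") auto
  from Suc.IH[OF b(1)[unfolded q'_def] this[unfolded q'_def] b(2)[unfolded q'_def]]
  show ?case by (simp add: mult_ac)
qed auto

text \<open>By Bernoulli, \<open>1 - x ^ j\<close> is at most \<open>j * (1 - x)\<close>. One factor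
  \<open>N\<close> bounds \<open>j\<close>, the other the number of coefficients.\<close>

lemma poly_near_1:
  fixes q :: "real poly"
  assumes H: "\<And>j. \<bar>coeff q j\<bar> \<le> H" and deg: "degree q < N" and x: "0 \<le> x" "x \<le> 1"
  shows "\<bar>poly q x - poly q 1\<bar> \<le> (real N)\<^sup>2 * H * (1 - x)"
proof -
  have H0: "0 \<le> H" using H[of 0] by linarith
  have "poly q x - poly q 1 = (\<Sum>j\<le>degree q. coeff q j * (x ^ j - 1))"
    by (simp add: poly_altdef sum_subtractf right_diff_distrib)
  also have "\<bar>\<dots>\<bar> \<le> (\<Sum>j\<le>degree q. \<bar>coeff q j * (x ^ j - 1)\<bar>)" by (rule sum_abs)
  also have "\<dots> \<le> (\<Sum>j\<le>degree q. H * (real N * (1 - x)))"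
  proof (rule sum_mono)
    fix j assume j: "j \<in> {..degree q}"
    have "1 + real j * (x - 1) \<le> x ^ j" using Bernoulli_inequality[of "x - 1" j] x by simp
    hence "1 - x ^ j \<le> real j * (1 - x)" by (simp add: algebra_simps)
    also have "\<dots> \<le> real N * (1 - x)" using j deg x by (intro mult_right_mono) auto
    finally have "\<bar>x ^ j - 1\<bar> \<le> real N * (1 - x)" using x power_le_one[of x j] by simp
    thus "\<bar>coeff q j * (x ^ j - 1)\<bar> \<le> H * (real N * (1 - x))"
      unfolding abs_mult using H H0 by (intro mult_mono) auto
  qed
  also have "\<dots> = real (Suc (degree q)) * (H * (real N * (1 - x)))" by simp
  also have "\<dots> \<le> real N * (H * (real N * (1 - x)))"
    using deg H0 x by (intro mult_right_mono) auto
  finally show ?thesis by (simp add: power2_eq_square mult_ac)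
qed

lemma poly_one_Ints:
  fixes q :: "real poly"
  assumes "\<And>j. coeff q j \<in> \<int>"
  shows "poly q 1 \<in> \<int>"
  using assms by (auto simp: poly_altdef intro!: Ints_sum)

text \<open>Write \<open>p = x ^ a * (x - 1) ^ k * q\<close> with \<open>q 1\<close> a nonzero integer. Near 1 the value of \<open>q\<close>
  stays close to \<open>q 1\<close>, where "near" depends only on the bound for \<open>k\<close>.\<close>
lemma sgn_poly_near_1:
  fixes p :: "real poly" and H :: real
  assumes H: "\<And>j. \<bar>coeff p j\<bar> \<le> H" and deg: "degree p < N" and int: "\<And>j. coeff p j \<in> \<int>"
    and m: "0 < m" "2 * H * (real N)\<^sup>2 \<le> real m ^ 4"
    and x: "0 < x" "x < 1" "H * real N ^ (2 * m) * (1 - x) < 1"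
    and y: "0 < y" "y < 1" "H * real N ^ (2 * m) * (1 - y) < 1"
  shows "sgn (poly p x) = sgn (poly p y)"
proof (cases "p = 0")
  case False
  have N: "0 < N" using deg by simp
  \<comment> \<open>Powers of x are split off because the bound on the order at 1 requires a nonzero
    constant coefficient; being an integer, it has absolute value at least 1.\<close>
  obtain p0 where p0: "p = [:-0, 1:] ^ order 0 p * p0" "\<not> [:-0, 1:] dvd p0"
    using order_decomp[OF False] by blast
  define a where "a = order 0 p"
  have pa: "p = monom 1 a * p0" using p0(1) by (simp add: a_def monom_altdef)
  have cp0: "coeff p0 j = coeff p (a + j)" for j
    unfolding pa coeff_monom_mult by simp
  have p0nz: "p0 \<noteq> 0" using False pa by auto
  have degp0: "degree p0 < N" using deg p0nz pa by (simp add: degree_mult_eq degree_monom_eq)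
  have c0: "coeff p0 0 \<noteq> 0" using p0(2) poly_eq_0_iff_dvd[of p0 0] by (simp add: poly_0_coeff_0)
  have c0': "1 \<le> \<bar>coeff p0 0\<bar>" using c0 int cp0 Ints_nonzero_abs_ge1 by metis
  obtain q where q: "p0 = [:-1, 1:] ^ order 1 p0 * q" "\<not> [:-1, 1:] dvd q"
    using order_decomp[OF p0nz, of 1] by blast
  define k where "k = order 1 p0"
  have pk: "p0 = [:-1, 1:] ^ k * q" using q(1) by (simp add: k_def)
  have k: "k < 2 * m - 1"
    using vanishing_order_at_1_less[OF _ degp0 c0' _ m] pk H by (metis cp0 dvd_triv_left)
  have q1: "poly q 1 \<noteq> 0" using q(2) by (simp add: poly_eq_0_iff_dvd)
  have b: "(\<forall>j. \<bar>coeff q j\<bar> \<le> real N ^ k * H \<and> coeff q j \<in> \<int>) \<and> degree q < N"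
    using factor_out_power_bound[of k q H N] H int cp0 degp0 unfolding pk[symmetric] by metis
  have q1': "1 \<le> \<bar>poly q 1\<bar>" using q1 b by (intro Ints_nonzero_abs_ge1 poly_one_Ints) auto
  have H0: "0 \<le> H" using H[of 0] by linarith
  have main: "sgn (poly p z) = (-1) ^ k * sgn (poly q 1)"
    if z: "0 < z" "z < 1" "H * real N ^ (2 * m) * (1 - z) < 1" for z
  proof -
    have "\<bar>poly q z - poly q 1\<bar> \<le> (real N)\<^sup>2 * (real N ^ k * H) * (1 - z)"
      using poly_near_1[of q "real N ^ k * H" N z] b z by simp
    also have "\<dots> = H * real N ^ (k + 2) * (1 - z)" by (simp add: power_add power2_eq_square mult_ac)
    \<comment> \<open>Here \<open>k + 2 \<le> 2 * m\<close>: \<open>k\<close> factors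
      \<open>N\<close> stem from the divisions by \<open>x - 1\<close>, two from moving away from
      1.\<close>
    also have "\<dots> \<le> H * real N ^ (2 * m) * (1 - z)"
      using k m N H0 z by (intro mult_right_mono mult_left_mono power_increasing) auto
    finally have "\<bar>poly q z - poly q 1\<bar> < \<bar>poly q 1\<bar>" using z q1' by linarith
    hence "sgn (poly q z) = sgn (poly q 1)" by (auto simp: sgn_real_def split: if_splits)
    moreover have "poly p z = z ^ a * ((z - 1) ^ k * poly q z)"
      by (simp add: pa pk poly_monom)
    moreover have "sgn (z - 1) = -1" using z by simp
    ultimately show ?thesis using z by (simp add: sgn_mult power_sgn[symmetric])
  qed
  show ?thesis using main x y by simp
qed simp

subsection \<open>Eventually periodic power series\<close>

text \<open>Coefficients of the generating function of \<open>d\<close> multiplied by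
  \<open>1 - x ^ c\<close>; the default 0 stands for the missing coefficients at negative
  indices.\<close>

definition lag_diff :: "nat \<Rightarrow> (nat \<Rightarrow> real) \<Rightarrow> nat \<Rightarrow> real" where
  "lag_diff c d i = d i - (if c \<le> i then d (i - c) else 0)"

text \<open>Commutation lets each of two sequences meet the lag equal to its own period
  first.\<close>

lemma lag_diff_commute: "lag_diff c (lag_diff c' d) = lag_diff c' (lag_diff c d)"
proof
  fix i
  have "c \<le> i - c' \<longleftrightarrow> c' \<le> i - c" if "c \<le> i" "c' \<le> i" using that by auto
  moreover have "i - c - c' = i - c' - c" by simp
  ultimately show "lag_diff c (lag_diff c' d) i = lag_diff c' (lag_diff c d) i"
    by (auto simp: lag_diff_def)
qed

lemma lag_diff_diff: "lag_diff c (\<lambda>i. a i - b i) = (\<lambda>i. lag_diff c a i - lag_diff c b i)"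
  by (auto simp: lag_diff_def)

lemma lag_diff_bound:
  assumes "\<And>i. \<bar>d i\<bar> \<le> H"
  shows "\<bar>lag_diff c d i\<bar> \<le> 2 * H"
  using assms[of i] assms[of "i - c"] by (auto simp: lag_diff_def abs_le_iff)

lemma lag_diff_Ints: "(\<And>i. d i \<in> \<int>) \<Longrightarrow> lag_diff c d i \<in> \<int>"
  by (auto simp: lag_diff_def)

lemma lag_diff_eventually_zero:
  assumes "\<And>i. q \<le> i \<Longrightarrow> d i = 0" "q + c \<le> i"
  shows "lag_diff c d i = 0"
  using assms by (auto simp: lag_diff_def)

lemma lag_diff_periodic:
  assumes "\<And>i. p \<le> i \<Longrightarrow> d (i + c) = d i" "p + c \<le> i"
  shows "lag_diff c d i = 0"
  using assms(1)[of "i - c"] assms(2) by (auto simp: lag_diff_def)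

lemma summable_bounded_geometric:
  fixes d :: "nat \<Rightarrow> real"
  assumes "\<And>i. \<bar>d i\<bar> \<le> H" "0 \<le> x" "x < 1"
  shows "summable (\<lambda>i. x ^ i * d i)"
proof (rule summable_comparison_test')
  show "summable (\<lambda>i. x ^ i * H)" using assms by (intro summable_mult2 summable_geometric) auto
  show "norm (x ^ i * d i) \<le> x ^ i * H" if "0 \<le> i" for i
    using assms by (auto simp: abs_mult intro!: mult_left_mono)
qed

lemma lag_diff_sums:
  assumes "(\<lambda>i. x ^ i * d i) sums s"
  shows "(\<lambda>i. x ^ i * lag_diff c d i) sums ((1 - x ^ c) * s)"
proof -
  define g where "g = (\<lambda>i. x ^ i * (if c \<le> i then d (i - c) else 0))"
  have "(\<lambda>i. g (i + c)) sums (x ^ c * s)"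
    using sums_mult[OF assms, of "x ^ c"] by (simp add: g_def power_add mult_ac)
  hence "g sums (x ^ c * s)"
    using sums_iff_shift[of g c "x ^ c * s"] by (simp add: g_def)
  from sums_diff[OF assms this] show ?thesis
    by (simp add: lag_diff_def g_def algebra_simps)
qed

text \<open>Multiplying by \<open>(1 - x ^ c) * (1 - x ^ c')\<close> turns the difference of the two series
  into a polynomial.\<close>
lemma eventually_periodic_series_le_iff:
  fixes a b :: "nat \<Rightarrow> real"
  assumes bounds: "\<And>i. \<bar>a i\<bar> \<le> W" "\<And>i. \<bar>b i\<bar> \<le> W"
    and ints: "\<And>i. a i \<in> \<int>" "\<And>i. b i \<in> \<int>"
    and per: "\<And>i. p \<le> i \<Longrightarrow> a (i + c) = a i" "\<And>i. p \<le> i \<Longrightarrow> b (i + c') = b i"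
    and pos: "0 < c" "0 < c'" and N: "p + c + c' \<le> N"
    and m: "0 < m" "2 * (8 * W) * (real N)\<^sup>2 \<le> real m ^ 4"
    and x: "0 < x" "x < 1" "8 * W * real N ^ (2 * m) * (1 - x) < 1"
    and y: "0 < y" "y < 1" "8 * W * real N ^ (2 * m) * (1 - y) < 1"
  shows "(\<Sum>i. x ^ i * a i) \<le> (\<Sum>i. x ^ i * b i) \<longleftrightarrow> (\<Sum>i. y ^ i * a i) \<le> (\<Sum>i. y ^ i * b i)"
proof -
  define e where "e = lag_diff c' (lag_diff c (\<lambda>i. b i - a i))"
  have e0: "e i = 0" if "N \<le> i" for i
  proof -
    have "e i = lag_diff c (lag_diff c' b) i - lag_diff c' (lag_diff c a) i"
      unfolding e_def by (simp add: lag_diff_diff lag_diff_commute[of c c' b])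
    moreover have "lag_diff c (lag_diff c' b) i = 0"
      using that N by (intro lag_diff_eventually_zero[of "p + c'"] lag_diff_periodic[of p b c', OF per(2)]) auto
    moreover have "lag_diff c' (lag_diff c a) i = 0"
      using that N by (intro lag_diff_eventually_zero[of "p + c"] lag_diff_periodic[of p a c, OF per(1)]) auto
    ultimately show ?thesis by simp
  qed
  have "\<bar>b i - a i\<bar> \<le> 2 * W" for i using bounds[of i] by (simp add: abs_le_iff)
  \<comment> \<open>Taking the difference doubles the bound \<open>W\<close>, and so does each of
    the two lags.\<close>
  from lag_diff_bound[OF lag_diff_bound[OF this]] have eb: "\<bar>e i\<bar> \<le> 8 * W" for i
    unfolding e_def by simp
  have ei: "e i \<in> \<int>" for i
    unfolding e_def using ints by (intro lag_diff_Ints Ints_diff)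
  define P where "P = (\<Sum>i<N. monom (e i) i)"
  have cP: "coeff P i = e i" for i
    using e0 by (cases "i < N") (auto simp: P_def coeff_sum)
  have Npos: "0 < N" using N pos by simp
  have dP: "degree P < N"
    using degree_lessI[of P N] cP e0 Npos by (metis linorder_not_less)
  have main: "(\<Sum>i. z ^ i * a i) \<le> (\<Sum>i. z ^ i * b i) \<longleftrightarrow> 0 \<le> sgn (poly P z)"
    if z: "0 < z" "z < 1" for z
  proof -
    have sa: "summable (\<lambda>i. z ^ i * a i)" and sb: "summable (\<lambda>i. z ^ i * b i)"
      using z bounds by (auto intro!: summable_bounded_geometric)
    define D where "D = (\<Sum>i. z ^ i * b i) - (\<Sum>i. z ^ i * a i)"
    have "(\<lambda>i. z ^ i * (b i - a i)) sums D"
      unfolding D_def right_diff_distrib by (intro sums_diff summable_sums sa sb)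
    from lag_diff_sums[OF lag_diff_sums[OF this], of c' c]
    have "(\<lambda>i. z ^ i * e i) sums ((1 - z ^ c') * ((1 - z ^ c) * D))" by (simp add: e_def)
    moreover have "(\<lambda>i. z ^ i * e i) sums (\<Sum>i<N. z ^ i * e i)"
      using e0 by (intro sums_finite) auto
    ultimately have "(1 - z ^ c') * ((1 - z ^ c) * D) = (\<Sum>i<N. z ^ i * e i)"
      by (rule sums_unique2)
    also have "\<dots> = poly P z" by (simp add: P_def poly_sum poly_monom mult.commute)
    finally have "poly P z = (1 - z ^ c') * ((1 - z ^ c) * D)" ..
    \<comment> \<open>Both multipliers are positive, so the polynomial has the sign of the
      difference of the series.\<close>
    moreover have "0 < 1 - z ^ c'" "0 < 1 - z ^ c"
      using z pos by (simp_all add: power_less_one_iff)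
    ultimately have "sgn (poly P z) = sgn D" by (simp add: sgn_mult)
    thus ?thesis by (simp add: D_def sgn_real_def)
  qed
  have "sgn (poly P x) = sgn (poly P y)"
    by (rule sgn_poly_near_1[of P "8 * W" N m]) (use cP eb ei dP m x y in auto)
  thus ?thesis using main[OF x(1,2)] main[OF y(1,2)] by metis
qed

subsection \<open>Discounted games and strategy iteration\<close>

abbreviation profile :: "nat set \<Rightarrow> (nat \<Rightarrow> nat) \<Rightarrow> (nat \<Rightarrow> nat) \<Rightarrow> nat \<Rightarrow> nat" where
  "profile V1 \<sigma> \<tau> x \<equiv> (if x \<in> V1 then \<sigma> x else \<tau> x)"

definition payoff :: "(nat \<Rightarrow> nat \<Rightarrow> int) \<Rightarrow> real \<Rightarrow> (nat \<Rightarrow> nat) \<Rightarrow> nat \<Rightarrow> real" where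
  "payoff r lam g v = (\<Sum>i. lam ^ i * real_of_int (r ((g ^^ i) v) ((g ^^ Suc i) v)))"

lemma disc_eq_payoff: "disc V1 r lam \<sigma> \<tau> v = payoff r lam (profile V1 \<sigma> \<tau>) v"
  by (simp add: disc_def payoff_def play_def)

text \<open>Strategies are total functions on the naturals; this cuts them down to the vertex set,
  where only finitely many remain.\<close>

lemma payoff_cong:
  assumes "\<And>x. x \<in> S \<Longrightarrow> g x = h x" "\<And>x. x \<in> S \<Longrightarrow> g x \<in> S" "v \<in> S"
  shows "payoff r lam g v = payoff r lam h v"
proof -
  have "(g ^^ i) v = (h ^^ i) v \<and> (g ^^ i) v \<in> S" for i
    by (induction i) (use assms in auto)
  hence "(g ^^ i) v = (h ^^ i) v" for i by blast
  thus ?thesis by (simp only: payoff_def)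
qed

locale discounted_game =
  fixes n :: nat and V1 :: "nat set" and E :: "(nat \<times> nat) set"
    and r :: "nat \<Rightarrow> nat \<Rightarrow> int" and lam :: real
  assumes n_pos: "0 < n" and game: "game n V1 E" and lam_nonneg: "0 \<le> lam" and lam_less_1: "lam < 1"
begin

definition max_reward :: real where "max_reward = maxabs_reward E r"

definition edge_map :: "(nat \<Rightarrow> nat) \<Rightarrow> bool" where
  "edge_map g \<longleftrightarrow> (\<forall>v<n. (v, g v) \<in> E)"

lemma finite_E: "finite E"
  using game by (auto simp: game_def intro: finite_subset[of _ "{..<n} \<times> {..<n}"])

lemma edge_less: "(v, u) \<in> E \<Longrightarrow> v < n \<and> u < n"
  using game by (auto simp: game_def)

lemma V1_less: "v \<in> V1 \<Longrightarrow> v < n"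
  using game by (auto simp: game_def)

lemma reward_bound: "(v, u) \<in> E \<Longrightarrow> \<bar>real_of_int (r v u)\<bar> \<le> max_reward"
proof -
  assume "(v, u) \<in> E"
  hence "\<bar>r v u\<bar> \<le> Max ((\<lambda>(v, u). \<bar>r v u\<bar>) ` E)"
    using finite_E by (intro Max_ge) (auto intro!: rev_image_eqI)
  thus ?thesis unfolding max_reward_def maxabs_reward_def by linarith
qed

lemma edge_map_profile:
  "\<sigma> \<in> strat1 n V1 E \<Longrightarrow> \<tau> \<in> strat2 n V1 E \<Longrightarrow> edge_map (profile V1 \<sigma> \<tau>)"
  by (auto simp: edge_map_def strat1_def strat2_def)

lemma edge_map_less: "edge_map g \<Longrightarrow> v < n \<Longrightarrow> g v < n"
  using edge_less by (auto simp: edge_map_def)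

lemma edge_map_funpow: "edge_map g \<Longrightarrow> v < n \<Longrightarrow> (g ^^ i) v < n"
  by (induction i) (auto intro: edge_map_less)

lemma edge_map_reward:
  "edge_map g \<Longrightarrow> v < n \<Longrightarrow> \<bar>real_of_int (r ((g ^^ i) v) ((g ^^ Suc i) v))\<bar> \<le> max_reward"
  using edge_map_funpow[of g v i] by (intro reward_bound) (simp add: edge_map_def)

lemma payoff_summable:
  assumes "edge_map g" "v < n"
  shows "summable (\<lambda>i. lam ^ i * real_of_int (r ((g ^^ i) v) ((g ^^ Suc i) v)))"
  using edge_map_reward[OF assms] lam_nonneg lam_less_1 by (rule summable_bounded_geometric)

text \<open>As a single power series, a one-step Bellman value becomes comparable by the same means
  as the payoff of a lasso.\<close>

lemma edge_then_path_series:
  assumes "edge_map g" "u < n"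
  shows "(\<Sum>i. lam ^ i * (case i of 0 \<Rightarrow> c | Suc j \<Rightarrow> real_of_int (r ((g ^^ j) u) ((g ^^ Suc j) u))))
    = c + lam * payoff r lam g u"
proof -
  let ?a = "\<lambda>i. lam ^ i * (case i of 0 \<Rightarrow> c | Suc j \<Rightarrow> real_of_int (r ((g ^^ j) u) ((g ^^ Suc j) u)))"
  have "(\<lambda>i. ?a (Suc i)) sums (lam * payoff r lam g u)"
    using sums_mult[OF summable_sums[OF payoff_summable[OF assms]], of lam]
    by (simp add: payoff_def mult_ac)
  hence "?a sums (lam * payoff r lam g u + ?a 0)" by (rule sums_Suc)
  thus ?thesis by (simp add: sums_iff add.commute)
qed

lemma payoff_unfold:
  assumes "edge_map g" "v < n"
  shows "payoff r lam g v = real_of_int (r v (g v)) + lam * payoff r lam g (g v)"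
proof -
  have "(case i of 0 \<Rightarrow> real_of_int (r v (g v))
      | Suc j \<Rightarrow> real_of_int (r ((g ^^ j) (g v)) ((g ^^ Suc j) (g v))))
    = real_of_int (r ((g ^^ i) v) ((g ^^ Suc i) v))" for i
    by (cases i) (simp_all add: funpow_swap1)
  thus ?thesis
    using edge_then_path_series[OF assms(1) edge_map_less[OF assms], of "real_of_int (r v (g v))"]
    unfolding payoff_def[of r lam g v] by simp
qed

text \<open>At a vertex \<open>w\<close> minimising \<open>d\<close> the hypothesis gives
  \<open>lam * d w \<le> d w\<close>, hence \<open>0 \<le> d w\<close>. The comparisons of a payoff
  with sub- and supersolutions of its one-step equation reduce to this.\<close>

lemma nonneg_if_contracting:
  fixes d :: "nat \<Rightarrow> real"
  assumes g: "\<And>v. v < n \<Longrightarrow> g v < n" and d: "\<And>v. v < n \<Longrightarrow> lam * d (g v) \<le> d v" and v: "v < n"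
  shows "0 \<le> d v"
proof -
  have "Min (d ` {..<n}) \<in> d ` {..<n}" using n_pos by (intro Min_in) auto
  then obtain w where "w < n" "d w = Min (d ` {..<n})" by auto
  hence w: "w < n" "\<And>x. x < n \<Longrightarrow> d w \<le> d x" by auto
  have "lam * d w \<le> lam * d (g w)" using w g lam_nonneg by (intro mult_left_mono) auto
  also have "\<dots> \<le> d w" using d w by blast
  finally have "0 \<le> (1 - lam) * d w" by (simp add: algebra_simps)
  hence "0 \<le> d w" using lam_less_1 by (simp add: zero_le_mult_iff)
  thus ?thesis using w v by force
qed

lemma le_payoff:
  assumes "edge_map g" "\<And>v. v < n \<Longrightarrow> h v \<le> real_of_int (r v (g v)) + lam * h (g v)" "v < n"
  shows "h v \<le> payoff r lam g v"
proof -
  have "0 \<le> payoff r lam g v - h v"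
  proof (rule nonneg_if_contracting[of g "\<lambda>v. payoff r lam g v - h v"])
    fix v assume "v < n"
    thus "lam * (payoff r lam g (g v) - h (g v)) \<le> payoff r lam g v - h v"
      using assms(2)[of v] payoff_unfold[OF assms(1), of v] by (simp add: right_diff_distrib)
  qed (use assms edge_map_less in auto)
  thus ?thesis by simp
qed

lemma payoff_le:
  assumes "edge_map g" "\<And>v. v < n \<Longrightarrow> real_of_int (r v (g v)) + lam * h (g v) \<le> h v" "v < n"
  shows "payoff r lam g v \<le> h v"
proof -
  have "0 \<le> h v - payoff r lam g v"
  proof (rule nonneg_if_contracting[of g "\<lambda>v. h v - payoff r lam g v"])
    fix v assume "v < n"
    thus "lam * (h (g v) - payoff r lam g (g v)) \<le> h v - payoff r lam g v"
      using assms(2)[of v] payoff_unfold[OF assms(1), of v] by (simp add: right_diff_distrib)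
  qed (use assms edge_map_less in auto)
  thus ?thesis by simp
qed

text \<open>Otherwise redirect \<open>\<tau>\<close> at \<open>v\<close> alone to \<open>u\<close>.
  The old values are then a supersolution for the new profile, so no payoff rises and the one at
  \<open>v\<close> falls strictly, contradicting the best response.\<close>

lemma best_response_bellman:
  assumes \<sigma>: "\<sigma> \<in> strat1 n V1 E" and br: "best_response n V1 E r lam \<sigma> \<tau>"
    and e: "(v, u) \<in> E" "v \<notin> V1"
  shows "disc V1 r lam \<sigma> \<tau> v \<le> real_of_int (r v u) + lam * disc V1 r lam \<sigma> \<tau> u"
proof (rule ccontr)
  assume neg: "\<not> ?thesis"
  define f where "f = disc V1 r lam \<sigma> \<tau>"
  define \<tau>' where "\<tau>' = \<tau>(v := u)"
  define g where "g = profile V1 \<sigma> \<tau>"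
  define g' where "g' = profile V1 \<sigma> \<tau>'"
  have \<tau>: "\<tau> \<in> strat2 n V1 E" using br by (simp add: best_response_def)
  have \<tau>': "\<tau>' \<in> strat2 n V1 E" using \<tau> e by (auto simp: strat2_def \<tau>'_def)
  have g: "edge_map g" "edge_map g'"
    unfolding g_def g'_def using edge_map_profile \<sigma> \<tau> \<tau>' by blast+
  have f: "f x = payoff r lam g x" for x unfolding f_def g_def by (rule disc_eq_payoff)
  have g'v: "g' v = u" using e by (simp add: g'_def \<tau>'_def)
  have v: "v < n" "u < n" using e edge_less by auto
  have le: "payoff r lam g' x \<le> f x" if "x < n" for x
  proof (rule payoff_le[OF g(2) _ that])
    fix y assume y: "y < n"
    show "real_of_int (r y (g' y)) + lam * f (g' y) \<le> f y"
    proof (cases "y = v")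
      case True
      thus ?thesis using neg g'v by (simp add: f_def)
    next
      case False
      hence "g' y = g y" by (simp add: g'_def g_def \<tau>'_def)
      thus ?thesis using payoff_unfold[OF g(1) y] by (simp add: f)
    qed
  qed
  have "payoff r lam g' v = real_of_int (r v u) + lam * payoff r lam g' u"
    using payoff_unfold[OF g(2) v(1)] g'v by simp
  also have "\<dots> \<le> real_of_int (r v u) + lam * f u"
    using le[OF v(2)] lam_nonneg by (simp add: mult_left_mono)
  also have "\<dots> < f v" using neg by (simp add: f_def)
  also have "f v \<le> payoff r lam g' v"
    using br \<tau>' v unfolding best_response_def f_def g'_def disc_eq_payoff by blast
  finally show False by simp
qed

lemma bellman1_edge_max:
  assumes "v < n"
  shows "(v, bellman1 E r lam f v) \<in> E"
    and "(v, u) \<in> E \<Longrightarrow> real_of_int (r v u) + lam * f u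
      \<le> real_of_int (r v (bellman1 E r lam f v)) + lam * f (bellman1 E r lam f v)"
proof -
  let ?q = "\<lambda>u. real_of_int (r v u) + lam * f u"
  let ?P = "\<lambda>u. (v, u) \<in> E \<and> (\<forall>u'. (v, u') \<in> E \<longrightarrow> ?q u' \<le> ?q u)"
  have fin: "finite {u. (v, u) \<in> E}"
    by (rule finite_subset[of _ "{..<n}"]) (auto dest: edge_less)
  have ne: "{u. (v, u) \<in> E} \<noteq> {}" using game assms by (auto simp: game_def)
  have "Max (?q ` {u. (v, u) \<in> E}) \<in> ?q ` {u. (v, u) \<in> E}"
    using fin ne by (intro Max_in) auto
  then obtain u0 where "(v, u0) \<in> E" "?q u0 = Max (?q ` {u. (v, u) \<in> E})" by auto
  hence "?P u0" using fin by auto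
  hence "?P (LEAST u. ?P u)" by (rule LeastI)
  hence P: "?P (bellman1 E r lam f v)" unfolding bellman1_def .
  show "(v, bellman1 E r lam f v) \<in> E" using P by blast
  show "(v, u) \<in> E \<Longrightarrow> ?q u \<le> ?q (bellman1 E r lam f v)" using P by blast
qed

text \<open>The least maximiser depends only on the order, ties included, of the one-step values.
  This covers a change of values as well as a change of discount factor.\<close>

lemma bellman1_cong:
  assumes "\<And>u u'. (v, u) \<in> E \<Longrightarrow> (v, u') \<in> E \<Longrightarrow>
    real_of_int (r v u') + lam * f u' \<le> real_of_int (r v u) + lam * f u \<longleftrightarrow>
    real_of_int (r v u') + lam' * f' u' \<le> real_of_int (r v u) + lam' * f' u"
  shows "bellman1 E r lam f v = bellman1 E r lam' f' v"
proof -
  have "((v, u) \<in> E \<and> (\<forall>u'. (v, u') \<in> E \<longrightarrow>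
      real_of_int (r v u') + lam * f u' \<le> real_of_int (r v u) + lam * f u)) \<longleftrightarrow>
    ((v, u) \<in> E \<and> (\<forall>u'. (v, u') \<in> E \<longrightarrow>
      real_of_int (r v u') + lam' * f' u' \<le> real_of_int (r v u) + lam' * f' u))" for u
    using assms by blast
  thus ?thesis unfolding bellman1_def by simp
qed

end

section \<open>Monotonicity and optimality of strategy iteration\<close>

locale strategy_iteration = discounted_game +
  fixes \<sigma> \<tau> :: "nat \<Rightarrow> nat \<Rightarrow> nat"
  assumes run: "SI_run n V1 E r lam \<sigma> \<tau>"
begin

definition value_at :: "nat \<Rightarrow> nat \<Rightarrow> real" where
  "value_at k = disc V1 r lam (\<sigma> k) (\<tau> k)"

definition move :: "nat \<Rightarrow> nat \<Rightarrow> nat" where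
  "move k = profile V1 (\<sigma> k) (\<tau> k)"

lemma response: "best_response n V1 E r lam (\<sigma> k) (\<tau> k)"
  using run by (simp add: SI_run_def)

lemma switch: "v \<in> V1 \<Longrightarrow> \<sigma> (Suc k) v = bellman1 E r lam (value_at k) v"
  using run by (simp add: SI_run_def value_at_def)

lemma \<tau>_strat: "\<tau> k \<in> strat2 n V1 E"
  using response[of k] by (simp add: best_response_def)

lemma \<sigma>_strat: "\<sigma> k \<in> strat1 n V1 E"
proof (cases k)
  case 0
  thus ?thesis using run by (simp add: SI_run_def)
next
  case (Suc j)
  thus ?thesis using bellman1_edge_max(1) switch V1_less by (simp add: strat1_def)
qed

lemma edge_map_move: "edge_map (move k)"
  unfolding move_def using \<sigma>_strat \<tau>_strat by (rule edge_map_profile)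

lemma value_at_payoff: "value_at k v = payoff r lam (move k) v"
  by (simp add: value_at_def move_def disc_eq_payoff)

lemma value_at_unfold:
  "v < n \<Longrightarrow> value_at k v = real_of_int (r v (move k v)) + lam * value_at k (move k v)"
  unfolding value_at_payoff by (rule payoff_unfold[OF edge_map_move])

lemma value_at_le_player2:
  "(v, u) \<in> E \<Longrightarrow> v \<notin> V1 \<Longrightarrow> value_at k v \<le> real_of_int (r v u) + lam * value_at k u"
  unfolding value_at_def using best_response_bellman[OF \<sigma>_strat response] .

lemma value_at_le_response:
  "t \<in> strat2 n V1 E \<Longrightarrow> v < n \<Longrightarrow> value_at k v \<le> payoff r lam (profile V1 (\<sigma> k) t) v"
  using response[of k] unfolding value_at_def best_response_def disc_eq_payoff by blast

text \<open>The old values are a subsolution for the new profile: at player 1's vertices the new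
  edge is a maximiser, elsewhere every edge satisfies the inequality of a best response.\<close>

lemma switch_improves:
  assumes "v < n"
  shows "value_at k v \<le> real_of_int (r v (move (Suc k) v)) + lam * value_at k (move (Suc k) v)"
proof (cases "v \<in> V1")
  case True
  have "(v, move k v) \<in> E" using edge_map_move assms by (simp add: edge_map_def)
  thus ?thesis
    using bellman1_edge_max(2)[OF assms, of "move k v" "value_at k"] value_at_unfold[OF assms, of k]
      switch[OF True] True by (simp add: move_def)
next
  case False
  thus ?thesis using value_at_le_player2 edge_map_move assms by (simp add: edge_map_def)
qed

lemma value_at_mono: "v < n \<Longrightarrow> value_at k v \<le> value_at (Suc k) v"
  unfolding value_at_payoff[of "Suc k"] by (rule le_payoff[OF edge_map_move switch_improves])

text \<open>An iteration gains at least as much as a round of value iteration: the greedy edge beats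
  \<open>u\<close> on the old values, and the new values are no smaller.\<close>

lemma value_iteration_le:
  assumes "v \<in> V1" "(v, u) \<in> E"
  shows "real_of_int (r v u) + lam * value_at k u \<le> value_at (Suc k) v"
proof -
  have v: "v < n" using assms edge_less by blast
  have "real_of_int (r v u) + lam * value_at k u
      \<le> real_of_int (r v (move (Suc k) v)) + lam * value_at k (move (Suc k) v)"
    using bellman1_edge_max(2)[OF v assms(2)] switch[OF assms(1)] assms(1) by (simp add: move_def)
  also have "\<dots> \<le> real_of_int (r v (move (Suc k) v)) + lam * value_at (Suc k) (move (Suc k) v)"
    using value_at_mono[OF edge_map_less[OF edge_map_move v]] lam_nonneg by (simp add: mult_left_mono)
  also have "\<dots> = value_at (Suc k) v" using value_at_unfold[OF v] by simp
  finally show ?thesis .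
qed

text \<open>Otherwise the sum of all values would increase forever, yet it is determined by the
  restriction of \<open>move k\<close> to a finite set. No rate results; the stationary value serves
  as the optimal value in the counting argument.\<close>

lemma value_at_stationary: "\<exists>K. \<forall>v<n. value_at (Suc K) v = value_at K v"
proof (rule ccontr)
  assume "\<not> ?thesis"
  hence neq: "\<exists>v<n. value_at (Suc k) v \<noteq> value_at k v" for k by blast
  have strict: "\<exists>v<n. value_at k v < value_at (Suc k) v" for k
  proof -
    obtain v where v: "v < n" "value_at (Suc k) v \<noteq> value_at k v" using neq by blast
    have "value_at k v < value_at (Suc k) v" using value_at_mono[OF v(1), of k] v(2) by linarith
    thus ?thesis using v(1) by blast
  qed
  define \<Phi> where "\<Phi> k = (\<Sum>v<n. value_at k v)" for k
  have "\<Phi> k < \<Phi> (Suc k)" for k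
    unfolding \<Phi>_def
  proof (rule sum_strict_mono_ex1)
    show "\<forall>v\<in>{..<n}. value_at k v \<le> value_at (Suc k) v" using value_at_mono by blast
    show "\<exists>v\<in>{..<n}. value_at k v < value_at (Suc k) v" using strict by blast
  qed simp
  hence "strict_mono \<Phi>" by (simp add: strict_mono_Suc_iff)
  hence "infinite (range \<Phi>)"
    using finite_imageD[of \<Phi> UNIV] strict_mono_imp_inj_on by auto
  moreover have "range \<Phi> \<subseteq> (\<lambda>g. \<Sum>v<n. payoff r lam g v) ` ({..<n} \<rightarrow>\<^sub>E {..<n})"
  proof safe
    fix k
    have "\<Phi> k = (\<Sum>v<n. payoff r lam (restrict (move k) {..<n}) v)"
      unfolding \<Phi>_def value_at_payoff
      by (intro sum.cong payoff_cong[of "{..<n}"]) (auto intro: edge_map_less[OF edge_map_move])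
    moreover have "restrict (move k) {..<n} \<in> {..<n} \<rightarrow>\<^sub>E {..<n}"
      using edge_map_less[OF edge_map_move] by auto
    ultimately show "\<Phi> k \<in> (\<lambda>g. \<Sum>v<n. payoff r lam g v) ` ({..<n} \<rightarrow>\<^sub>E {..<n})" by blast
  qed
  hence "finite (range \<Phi>)" by (rule finite_subset) (intro finite_imageI finite_PiE; simp)
  ultimately show False by blast
qed

text \<open>The response \<open>\<tau> k\<close> certifies the upper bound: with it fixed, the
  current values are a supersolution for every strategy of player 1.\<close>

lemma optimal_if_bellman:
  assumes "\<And>v u. v \<in> V1 \<Longrightarrow> (v, u) \<in> E \<Longrightarrow> real_of_int (r v u) + lam * value_at k u \<le> value_at k v"
  shows "optimal1 n V1 E r lam (\<sigma> k)"
proof -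
  have inf_eq: "(INF t\<in>strat2 n V1 E. disc V1 r lam (\<sigma> k) t v) = value_at k v" if "v < n" for v
    using that \<tau>_strat[of k] response[of k]
    by (intro cInf_eq_minimum) (auto simp: value_at_def best_response_def)
  have le: "(INF t\<in>strat2 n V1 E. disc V1 r lam s t v) \<le> value_at k v"
    if s: "s \<in> strat1 n V1 E" and v: "v < n" for s v
  proof -
    define g where "g = profile V1 s (\<tau> k)"
    have g: "edge_map g" unfolding g_def using s \<tau>_strat by (rule edge_map_profile)
    have "payoff r lam g v \<le> value_at k v"
    proof (rule payoff_le[OF g _ v])
      fix x assume x: "x < n"
      show "real_of_int (r x (g x)) + lam * value_at k (g x) \<le> value_at k x"
      proof (cases "x \<in> V1")
        case True
        thus ?thesis using assms g x by (simp add: edge_map_def)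
      next
        case False
        thus ?thesis using value_at_unfold[OF x, of k] by (simp add: g_def move_def)
      qed
    qed
    \<comment> \<open>A real infimum is a lower bound only for sets bounded below; the constant is
      the payoff of an endless stream of rewards \<open>- max_reward\<close>.\<close>
    moreover have "bdd_below ((\<lambda>t. disc V1 r lam s t v) ` strat2 n V1 E)"
    proof (rule bdd_belowI2)
      fix t assume t: "t \<in> strat2 n V1 E"
      have e: "edge_map (profile V1 s t)" using s t by (rule edge_map_profile)
      have "- max_reward / (1 - lam) \<le> payoff r lam (profile V1 s t) v"
      proof (rule le_payoff[OF e _ v])
        fix x assume "x < n"
        hence "- max_reward \<le> real_of_int (r x (profile V1 s t x))"
          using e reward_bound[of x "profile V1 s t x"] by (simp add: edge_map_def abs_le_iff)
        moreover have "- max_reward / (1 - lam) = - max_reward + lam * (- max_reward / (1 - lam))"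
          using lam_less_1 by (simp add: field_simps)
        ultimately show "- max_reward / (1 - lam)
            \<le> real_of_int (r x (profile V1 s t x)) + lam * (- max_reward / (1 - lam))"
          by linarith
      qed
      thus "- max_reward / (1 - lam) \<le> disc V1 r lam s t v" by (simp only: disc_eq_payoff)
    qed
    ultimately show ?thesis
      using cINF_lower2[OF _ \<tau>_strat[of k]] unfolding disc_eq_payoff g_def by blast
  qed
  have "val n V1 E r lam v = value_at k v" if v: "v < n" for v
    unfolding val_def
  proof (rule cSup_eq_maximum)
    show "value_at k v \<in> (\<lambda>s. INF t\<in>strat2 n V1 E. disc V1 r lam s t v) ` strat1 n V1 E"
      by (rule image_eqI[where x = "\<sigma> k"]) (simp_all only: inf_eq[OF v] \<sigma>_strat)
    show "y \<le> value_at k v"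
      if "y \<in> (\<lambda>s. INF t\<in>strat2 n V1 E. disc V1 r lam s t v) ` strat1 n V1 E" for y
      using that le[OF _ v] by blast
  qed
  thus ?thesis using inf_eq \<sigma>_strat by (simp add: optimal1_def)
qed

lemma stops_imp_optimal:
  assumes "SI_stops_at V1 \<sigma> k"
  shows "optimal1 n V1 E r lam (\<sigma> k)"
proof (rule optimal_if_bellman)
  fix v u assume v: "v \<in> V1" and e: "(v, u) \<in> E"
  have "\<sigma> k v = bellman1 E r lam (value_at k) v"
    using assms v switch[OF v, of k] by (simp add: SI_stops_at_def)
  thus "real_of_int (r v u) + lam * value_at k u \<le> value_at k v"
    using bellman1_edge_max(2)[OF V1_less[OF v] e, of "value_at k"] value_at_unfold[OF V1_less[OF v], of k] v
    by (simp add: move_def)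
qed

text \<open>Equal values give equal greedy choices, also under ties. The shift to
  \<open>Suc k\<close> matters because \<open>\<sigma> k\<close> may be the initial strategy, which
  need not be greedy.\<close>

lemma stops_if_stationary:
  assumes "\<And>v. v < n \<Longrightarrow> value_at (Suc k) v = value_at k v"
  shows "SI_stops_at V1 \<sigma> (Suc k)"
  unfolding SI_stops_at_def
proof
  fix v assume v: "v \<in> V1"
  have "bellman1 E r lam (value_at (Suc k)) v = bellman1 E r lam (value_at k) v"
    using edge_less assms by (intro bellman1_cong) auto
  thus "\<sigma> (Suc (Suc k)) v = \<sigma> (Suc k) v" using switch[OF v] by simp
qed

end

subsection \<open>The iteration bound\<close>

text \<open>Hansen, Miltersen and Zwick: let \<open>vs\<close> be the optimal value. At any iteration some edge chosen
  by player 1 has a reduced cost with respect to \<open>vs\<close> that is at least \<open>1 - lam\<close> times the current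
  distance to \<open>vs\<close>, whereas an edge in use never has a reduced cost above that distance. As the
  distance shrinks by \<open>lam\<close> in every iteration, this edge is no longer used \<open>L\<close> iterations later.\<close>
lemma (in strategy_iteration) stops_within:
  assumes L: "lam ^ L < 1 - lam"
  shows "\<exists>k \<le> n * n * L + 1. SI_stops_at V1 \<sigma> k"
proof -
  obtain K where K: "\<And>v. v < n \<Longrightarrow> value_at (Suc K) v = value_at K v"
    using value_at_stationary by blast
  define vs where "vs = value_at K"
  have vs1: "real_of_int (r v u) + lam * vs u \<le> vs v" if "v \<in> V1" "(v, u) \<in> E" for v u
    using value_iteration_le[OF that, of K] K V1_less[OF that(1)] by (simp add: vs_def)
  have vs2: "vs v \<le> real_of_int (r v u) + lam * vs u" if "v \<notin> V1" "(v, u) \<in> E" for v u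
    using value_at_le_player2[OF that(2,1)] by (simp add: vs_def)
  have vsK: "vs v = real_of_int (r v (move K v)) + lam * vs (move K v)" if "v < n" for v
    using value_at_unfold[OF that] by (simp add: vs_def)
  have against_optimal: "payoff r lam (profile V1 (\<sigma> k) (\<tau> K)) v \<le> vs v" if "v < n" for k v
  proof (rule payoff_le[OF edge_map_profile[OF \<sigma>_strat \<tau>_strat] _ that])
    fix x assume x: "x < n"
    show "real_of_int (r x (profile V1 (\<sigma> k) (\<tau> K) x)) + lam * vs (profile V1 (\<sigma> k) (\<tau> K) x) \<le> vs x"
    proof (cases "x \<in> V1")
      case True
      thus ?thesis using vs1[OF True] \<sigma>_strat[of k] by (simp add: strat1_def)
    next
      case False
      thus ?thesis using vsK[OF x] by (simp add: move_def)
    qed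
  qed
  have le_vs: "value_at k v \<le> vs v" if "v < n" for k v
    using value_at_le_response[OF \<tau>_strat that] against_optimal[OF that] by (rule order_trans)
  define c where "c v u = vs v - real_of_int (r v u) - lam * vs u" for v u
  \<comment> \<open>Player 2 may answer \<open>\<sigma> k\<close> with \<open>\<tau> K\<close>,
    which limits the continuation after the first edge to \<open>vs\<close>; the loss is then at
    least the reduced cost.\<close>
  have c_le: "c v (\<sigma> k v) \<le> vs v - value_at k v" if v: "v \<in> V1" for k v
  proof -
    define g where "g = profile V1 (\<sigma> k) (\<tau> K)"
    have g: "edge_map g" unfolding g_def by (rule edge_map_profile[OF \<sigma>_strat \<tau>_strat])
    have gv: "g v = \<sigma> k v" using v by (simp add: g_def)
    have "value_at k v \<le> payoff r lam g v"
      using value_at_le_response[OF \<tau>_strat V1_less[OF v]] by (simp add: g_def)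
    also have "\<dots> = real_of_int (r v (g v)) + lam * payoff r lam g (g v)"
      by (rule payoff_unfold[OF g V1_less[OF v]])
    also have "\<dots> \<le> real_of_int (r v (g v)) + lam * vs (g v)"
      using against_optimal[OF edge_map_less[OF g V1_less[OF v]], of k] lam_nonneg
      by (intro add_left_mono mult_left_mono) (simp_all add: g_def)
    finally show ?thesis by (simp add: c_def gv)
  qed
  define \<epsilon> where "\<epsilon> k = Max ((\<lambda>v. vs v - value_at k v) ` {..<n})" for k
  have \<epsilon>_ge: "vs v - value_at k v \<le> \<epsilon> k" if "v < n" for k v
    unfolding \<epsilon>_def using that by (intro Max_ge) auto
  have \<epsilon>_attained: "\<exists>v<n. \<epsilon> k = vs v - value_at k v" for k
  proof -
    have "\<epsilon> k \<in> (\<lambda>v. vs v - value_at k v) ` {..<n}"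
      unfolding \<epsilon>_def using n_pos by (intro Max_in) auto
    thus ?thesis by auto
  qed
  have \<epsilon>_nonneg: "0 \<le> \<epsilon> k" for k
    using \<epsilon>_attained[of k] le_vs[of _ k] by auto
  have \<epsilon>_Suc: "\<epsilon> (Suc k) \<le> lam * \<epsilon> k" for k
  proof -
    obtain v where v: "v < n" "\<epsilon> (Suc k) = vs v - value_at (Suc k) v"
      using \<epsilon>_attained by blast
    have "\<exists>u<n. vs v - value_at (Suc k) v \<le> lam * (vs u - value_at k u)"
    proof (cases "v \<in> V1")
      case True
      have e: "(v, move K v) \<in> E" using edge_map_move v by (simp add: edge_map_def)
      have "real_of_int (r v (move K v)) + lam * value_at k (move K v) \<le> value_at (Suc k) v"
        by (rule value_iteration_le[OF True e])
      hence "vs v - value_at (Suc k) v \<le> lam * (vs (move K v) - value_at k (move K v))"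
        using vsK[OF v(1)] by (simp add: right_diff_distrib)
      thus ?thesis using edge_less[OF e] by blast
    next
      case False
      define u where "u = move (Suc k) v"
      have e: "(v, u) \<in> E" using edge_map_move v by (simp add: edge_map_def u_def)
      have u: "u < n" using edge_less[OF e] by blast
      have "lam * value_at k u \<le> lam * value_at (Suc k) u"
        using value_at_mono[OF u] lam_nonneg by (rule mult_left_mono)
      hence "vs v - value_at (Suc k) v \<le> lam * (vs u - value_at k u)"
        using vs2[OF False e] value_at_unfold[OF v(1), of "Suc k", folded u_def]
        by (simp add: right_diff_distrib)
      thus ?thesis using u by blast
    qed
    then obtain u where u: "u < n" "vs v - value_at (Suc k) v \<le> lam * (vs u - value_at k u)" by blast
    have "lam * (vs u - value_at k u) \<le> lam * \<epsilon> k"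
      using \<epsilon>_ge[OF u(1)] lam_nonneg by (rule mult_left_mono)
    thus ?thesis using v u by linarith
  qed
  have \<epsilon>_add: "\<epsilon> (k + j) \<le> lam ^ j * \<epsilon> k" for k j
  proof (induction j)
    case (Suc j)
    have "\<epsilon> (k + Suc j) \<le> lam * \<epsilon> (k + j)" using \<epsilon>_Suc[of "k + j"] by simp
    also have "\<dots> \<le> lam * (lam ^ j * \<epsilon> k)" using Suc lam_nonneg by (rule mult_left_mono)
    finally show ?case by (simp add: mult_ac)
  qed simp
  \<comment> \<open>Where the distance is largest, it equals the reduced cost of the edge in use
    plus \<open>lam\<close> times a distance of at most \<open>\<epsilon> k\<close>. Reduced costs
    at player 2's vertices are nonpositive, so the vertex belongs to player 1.\<close>
  have costly_edge: "\<exists>v\<in>V1. (1 - lam) * \<epsilon> k \<le> c v (\<sigma> k v)" if pos: "0 < \<epsilon> k" for k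
  proof (rule ccontr)
    assume neg: "\<not> ?thesis"
    obtain v where v: "v < n" "\<epsilon> k = vs v - value_at k v" using \<epsilon>_attained by blast
    define u where "u = move k v"
    have e: "(v, u) \<in> E" using edge_map_move v by (simp add: edge_map_def u_def)
    have "c v u < (1 - lam) * \<epsilon> k"
    proof (cases "v \<in> V1")
      case True
      thus ?thesis using neg by (auto simp: u_def move_def)
    next
      case False
      have "0 < (1 - lam) * \<epsilon> k" using pos lam_less_1 by simp
      thus ?thesis using vs2[OF False e] by (simp add: c_def)
    qed
    moreover have "\<epsilon> k = c v u + lam * (vs u - value_at k u)"
      using value_at_unfold[OF v(1), of k, folded u_def] v(2) by (simp add: c_def right_diff_distrib)
    moreover have "lam * (vs u - value_at k u) \<le> lam * \<epsilon> k"
      using \<epsilon>_ge edge_less[OF e] lam_nonneg by (intro mult_left_mono) auto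
    ultimately show False by (simp add: left_diff_distrib)
  qed
  \<comment> \<open>Otherwise \<open>n * n + 1\<close> checkpoints with spacing \<open>L\<close>
    yield as many different costly edges, more than there are pairs of vertices.\<close>
  have "\<exists>i \<le> n * n. \<epsilon> (i * L) = 0"
  proof (rule ccontr)
    assume "\<not> ?thesis"
    hence pos: "0 < \<epsilon> (i * L)" if "i \<le> n * n" for i
      using that \<epsilon>_nonneg[of "i * L"] by (metis order_le_less)
    have "\<forall>i\<in>{..n * n}. \<exists>v. v \<in> V1 \<and> (1 - lam) * \<epsilon> (i * L) \<le> c v (\<sigma> (i * L) v)"
      using costly_edge pos by blast
    then obtain w where w: "\<And>i. i \<le> n * n \<Longrightarrow> w i \<in> V1"
        "\<And>i. i \<le> n * n \<Longrightarrow> (1 - lam) * \<epsilon> (i * L) \<le> c (w i) (\<sigma> (i * L) (w i))"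
      unfolding bchoice_iff by auto
    define e where "e i = (w i, \<sigma> (i * L) (w i))" for i
    have distinct: "e i \<noteq> e j" if "i < j" "j \<le> n * n" for i j
    proof
      assume eq: "e i = e j"
      have i: "i \<le> n * n" using that by simp
      have "(1 - lam) * \<epsilon> (i * L) \<le> c (w j) (\<sigma> (j * L) (w j))"
        using w(2)[OF i] eq unfolding e_def prod.inject by metis
      also have "\<dots> \<le> \<epsilon> (j * L)"
        using c_le[OF w(1)[OF that(2)]] \<epsilon>_ge[OF V1_less[OF w(1)[OF that(2)]]] by (rule order_trans)
      also have "\<dots> = \<epsilon> (i * L + (j - i) * L)"
        using that by (simp add: diff_mult_distrib)
      also have "\<dots> \<le> lam ^ ((j - i) * L) * \<epsilon> (i * L)" by (rule \<epsilon>_add)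
      also have "\<dots> \<le> lam ^ L * \<epsilon> (i * L)"
        using lam_nonneg lam_less_1 that \<epsilon>_nonneg
        by (intro mult_right_mono power_decreasing) auto
      also have "\<dots> < (1 - lam) * \<epsilon> (i * L)" using L pos[OF i] by (rule mult_strict_right_mono)
      finally show False by simp
    qed
    have "inj_on e {..n * n}"
    proof (rule inj_onI)
      fix i j assume "i \<in> {..n * n}" "j \<in> {..n * n}" "e i = e j"
      thus "i = j" using distinct[of i j] distinct[of j i] by (cases i j rule: linorder_cases) auto
    qed
    moreover have "e ` {..n * n} \<subseteq> {..<n} \<times> {..<n}"
    proof (rule image_subsetI)
      fix i assume "i \<in> {..n * n}"
      hence "w i \<in> V1" using w(1) by simp
      hence "e i \<in> E" using \<sigma>_strat[of "i * L"] by (simp add: e_def strat1_def)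
      thus "e i \<in> {..<n} \<times> {..<n}" using edge_less by (simp add: e_def)
    qed
    ultimately have "card {..n * n} \<le> card ({..<n} \<times> {..<n})"
      by (intro card_inj_on_le) auto
    thus False by (simp add: card_cartesian_product)
  qed
  then obtain i where i: "i \<le> n * n" "\<epsilon> (i * L) = 0" by blast
  have eq: "value_at (i * L) v = vs v" if "v < n" for v
    using \<epsilon>_ge[OF that, of "i * L"] le_vs[OF that, of "i * L"] i(2) by linarith
  have "value_at (Suc (i * L)) v = value_at (i * L) v" if "v < n" for v
    using eq[OF that] le_vs[OF that, of "Suc (i * L)"] value_at_mono[OF that, of "i * L"] by linarith
  hence "SI_stops_at V1 \<sigma> (Suc (i * L))" by (rule stops_if_stationary)
  moreover have "Suc (i * L) \<le> n * n * L + 1" using i(1) by simp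
  ultimately show ?thesis by blast
qed

section \<open>Transfer of a run to another discount factor\<close>

text \<open>The bound \<open>n\<close> on the prefix also absorbs one edge put in front of a lasso.
  Prefix and two periods together give the length \<open>3 * n\<close> used for the
  polynomials.\<close>

definition lasso_sequence :: "nat \<Rightarrow> real \<Rightarrow> (nat \<Rightarrow> real) \<Rightarrow> bool" where
  "lasso_sequence n W a \<longleftrightarrow> (\<forall>i. \<bar>a i\<bar> \<le> W \<and> a i \<in> \<int>) \<and>
     (\<exists>c. 0 < c \<and> c \<le> n \<and> (\<forall>i\<ge>n. a (i + c) = a i))"

definition near_one :: "nat \<Rightarrow> real \<Rightarrow> nat \<Rightarrow> real \<Rightarrow> bool" where
  "near_one n W m x \<longleftrightarrow> 0 < x \<and> x < 1 \<and> 8 * W * real (3 * n) ^ (2 * m) * (1 - x) < 1"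

lemma lasso_series_le_iff:
  assumes "lasso_sequence n W a" "lasso_sequence n W b"
    and "0 < m" "16 * W * (real (3 * n))\<^sup>2 \<le> real m ^ 4"
    and "near_one n W m x" "near_one n W m y"
  shows "(\<Sum>i. x ^ i * a i) \<le> (\<Sum>i. x ^ i * b i) \<longleftrightarrow> (\<Sum>i. y ^ i * a i) \<le> (\<Sum>i. y ^ i * b i)"
proof -
  obtain c where c: "0 < c" "c \<le> n" "\<And>i. n \<le> i \<Longrightarrow> a (i + c) = a i"
    using assms(1) by (auto simp: lasso_sequence_def)
  obtain c' where c': "0 < c'" "c' \<le> n" "\<And>i. n \<le> i \<Longrightarrow> b (i + c') = b i"
    using assms(2) by (auto simp: lasso_sequence_def)
  show ?thesis
    by (rule eventually_periodic_series_le_iff[where W = W and p = n and c = c and c' = c'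
          and N = "3 * n" and m = m])
       (use assms c c' in \<open>auto simp: lasso_sequence_def near_one_def\<close>)
qed

context discounted_game
begin

text \<open>Among the iterates 0, ..., n of \<open>v\<close> two coincide, the earlier at an index
  of at most \<open>n - 1\<close>. Periodicity thus starts at \<open>n - 1\<close>, which leaves
  room for an edge in front.\<close>

lemma funpow_periodic:
  assumes "edge_map g" "v < n"
  obtains c where "0 < c" "c \<le> n" "\<And>i. n \<le> Suc i \<Longrightarrow> (g ^^ (i + c)) v = (g ^^ i) v"
proof -
  have "(\<lambda>i. (g ^^ i) v) ` {..n} \<subseteq> {..<n}" using edge_map_funpow[OF assms] by auto
  hence "card ((\<lambda>i. (g ^^ i) v) ` {..n}) \<le> n" using card_mono[of "{..<n}"] by fastforce
  hence "\<not> inj_on (\<lambda>i. (g ^^ i) v) {..n}" by (intro pigeonhole) simp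
  then obtain i j where ij: "i \<le> n" "j \<le> n" "i \<noteq> j" "(g ^^ i) v = (g ^^ j) v"
    by (auto simp: inj_on_def)
  define p q where "p = min i j" and "q = max i j"
  have pq: "p < q" "q \<le> n" "(g ^^ q) v = (g ^^ p) v"
    using ij by (auto simp: p_def q_def min_def max_def)
  have "(g ^^ (k + (q - p))) v = (g ^^ k) v" if "n \<le> Suc k" for k
  proof -
    have "k + (q - p) = (k - p) + q" "k = (k - p) + p" using that pq by auto
    thus ?thesis using pq(3) by (metis comp_apply funpow_add)
  qed
  thus ?thesis using that[of "q - p"] pq by simp
qed

lemma lasso_sequence_path:
  assumes "edge_map g" "v < n"
  shows "lasso_sequence n max_reward (\<lambda>i. real_of_int (r ((g ^^ i) v) ((g ^^ Suc i) v)))"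
proof -
  obtain c where c: "0 < c" "c \<le> n" "\<And>i. n \<le> Suc i \<Longrightarrow> (g ^^ (i + c)) v = (g ^^ i) v"
    using funpow_periodic[OF assms] by blast
  thus ?thesis using edge_map_reward[OF assms] by (auto simp: lasso_sequence_def intro!: exI[of _ c])
qed

lemma lasso_sequence_edge_path:
  assumes "edge_map g" "(v, u) \<in> E"
  shows "lasso_sequence n max_reward (\<lambda>i. case i of 0 \<Rightarrow> real_of_int (r v u)
     | Suc j \<Rightarrow> real_of_int (r ((g ^^ j) u) ((g ^^ Suc j) u)))"
    (is "lasso_sequence n max_reward ?a")
proof -
  have u: "u < n" using assms edge_less by blast
  obtain c where c: "0 < c" "c \<le> n" "\<And>i. n \<le> Suc i \<Longrightarrow> (g ^^ (i + c)) u = (g ^^ i) u"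
    using funpow_periodic[OF assms(1) u] by blast
  have "\<bar>?a i\<bar> \<le> max_reward \<and> ?a i \<in> \<int>" for i
    using reward_bound[OF assms(2)] edge_map_reward[OF assms(1) u] by (cases i) auto
  moreover have "?a (i + c) = ?a i" if "n \<le> i" for i
    using that c(3) n_pos by (cases i) auto
  ultimately show ?thesis using c(1,2) by (auto simp: lasso_sequence_def)
qed

end

text \<open>Both conditions on a run compare lasso series: a best response compares two profiles
  from one vertex, the greedy step two edges followed by paths of the same profile.\<close>

lemma (in strategy_iteration) SI_run_near_one:
  assumes m: "0 < m" "16 * max_reward * (real (3 * n))\<^sup>2 \<le> real m ^ 4"
    and near: "near_one n max_reward m lam" "near_one n max_reward m lam'"
  shows "SI_run n V1 E r lam' \<sigma> \<tau>"
proof -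
  interpret other: discounted_game n V1 E r lam'
    using n_pos game near(2) by unfold_locales (auto simp: near_one_def)
  have payoff_iff: "payoff r lam g v \<le> payoff r lam h v \<longleftrightarrow> payoff r lam' g v \<le> payoff r lam' h v"
    if "edge_map g" "edge_map h" "v < n" for g h v
    unfolding payoff_def using that
    by (intro lasso_series_le_iff[OF _ _ m near] lasso_sequence_path)
  have edge_payoff_iff: "real_of_int (r v u') + lam * payoff r lam g u'
      \<le> real_of_int (r v u) + lam * payoff r lam g u \<longleftrightarrow>
    real_of_int (r v u') + lam' * payoff r lam' g u' \<le> real_of_int (r v u) + lam' * payoff r lam' g u"
    if "edge_map g" "(v, u) \<in> E" "(v, u') \<in> E" for g v u u'
  proof -
    have u: "u < n" "u' < n" using that edge_less by auto
    show ?thesis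
      unfolding edge_then_path_series[OF that(1) u(1), symmetric]
        edge_then_path_series[OF that(1) u(2), symmetric]
        other.edge_then_path_series[OF that(1) u(1), symmetric]
        other.edge_then_path_series[OF that(1) u(2), symmetric]
      using that by (intro lasso_series_le_iff[OF _ _ m near] lasso_sequence_edge_path)
  qed
  show ?thesis
    unfolding SI_run_def
  proof (intro conjI allI ballI)
    show "\<sigma> 0 \<in> strat1 n V1 E" by (rule \<sigma>_strat)
    show "best_response n V1 E r lam' (\<sigma> k) (\<tau> k)" for k
      unfolding best_response_def
    proof (intro conjI ballI allI impI)
      show "\<tau> k \<in> strat2 n V1 E" by (rule \<tau>_strat)
      fix t v assume "t \<in> strat2 n V1 E" "v < n"
      thus "disc V1 r lam' (\<sigma> k) (\<tau> k) v \<le> disc V1 r lam' (\<sigma> k) t v"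
        using value_at_le_response[of t v k]
          payoff_iff[OF edge_map_move edge_map_profile[OF \<sigma>_strat], of t v k k]
        unfolding disc_eq_payoff value_at_payoff move_def by blast
    qed
    show "\<sigma> (Suc k) v = bellman1 E r lam' (disc V1 r lam' (\<sigma> k) (\<tau> k)) v" if "v \<in> V1" for k v
      unfolding switch[OF that] value_at_def disc_eq_payoff
      using edge_payoff_iff[OF edge_map_move[of k, unfolded move_def]] by (intro bellman1_cong)
  qed
qed

section \<open>Estimates for the final bound\<close>

text \<open>Let s = 1 - lam, so that \<open>lam * (1 + s)\<close> is 1 - s^2. If
  \<open>lam ^ L\<close> were at least s, Bernoulli would give s (1 + L s) \<le> (1 - s^2)^L \<le>
  1, although L s^2 \<ge> 1. A quadratic \<open>L\<close> is affordable and avoids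
  logarithms.\<close>

lemma power_less_gap:
  fixes lam X :: real
  assumes "0 \<le> lam" "lam < 1" "1 / (1 - lam) \<le> X" "X\<^sup>2 \<le> real L"
  shows "lam ^ L < 1 - lam"
proof (rule ccontr)
  assume neg: "\<not> ?thesis"
  define s where "s = 1 - lam"
  have s: "0 < s" "1 \<le> X * s" using assms by (auto simp: s_def pos_divide_le_eq)
  have "(lam * (1 + s)) ^ L \<le> 1"
  proof (rule power_le_one)
    show "0 \<le> lam * (1 + s)" using assms s by simp
    have "lam * (1 + s) = 1 - s\<^sup>2" by (simp add: s_def power2_eq_square algebra_simps)
    thus "lam * (1 + s) \<le> 1" by simp
  qed
  moreover have "1 + real L * s \<le> (1 + s) ^ L"
    using Bernoulli_inequality[of s L] s by (simp add: mult.commute)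
  hence "s * (1 + real L * s) \<le> lam ^ L * (1 + s) ^ L"
    using neg s assms by (intro mult_mono) (auto simp: s_def)
  moreover have "1 \<le> real L * s * s"
  proof -
    have "1 \<le> (X * s)\<^sup>2" using s by (simp add: one_le_power)
    also have "\<dots> = X\<^sup>2 * (s * s)" by (simp add: power_mult_distrib power2_eq_square)
    also have "\<dots> \<le> real L * (s * s)" using assms s by (intro mult_right_mono) auto
    finally show ?thesis by (simp add: mult.assoc)
  qed
  moreover have "s * (1 + real L * s) = s + real L * s * s" by (simp add: algebra_simps)
  ultimately show False using s(1) unfolding power_mult_distrib by linarith
qed

text \<open>This absorbs powers of W: applied to the fourth root w of W it gives W \<le> 2 powr (8
  w), with an exponent linear in W powr (1/4).\<close>

lemma le_two_powr:
  fixes w :: real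
  assumes "0 \<le> w"
  shows "w \<le> 2 powr (2 * w)"
proof -
  have "1 \<le> 2 * ln (2::real)" using ln_le_minus_one[of "1 / 2 :: real"] by (simp add: ln_div)
  have "w \<le> exp w" using exp_ge_add_one_self[of w] by linarith
  also have "w * 1 \<le> w * (2 * ln 2)" using assms \<open>1 \<le> 2 * ln 2\<close> by (intro mult_left_mono)
  hence "exp w \<le> exp (2 * w * ln 2)" by (simp add: mult_ac)
  also have "\<dots> = 2 powr (2 * w)" by (simp add: powr_def)
  finally show ?thesis .
qed

text \<open>The exponents are 12 for 768 n^2, 16 y for W^2, and 60 y for the power of 3n, since 12 m
  \<le> 48 y + 12 and 1 \<le> y. Their sum stays below 90 y.\<close>

lemma iteration_bound:
  fixes n m :: nat and W y :: real
  assumes n: "2 \<le> n" and W: "1 \<le> W" and y: "y = W powr (1/4) * sqrt (real n)"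
    and m: "real m \<le> 4 * y + 1"
  shows "3 * (real n)\<^sup>2 * (16 * W * real (3 * n) ^ (2 * m))\<^sup>2 \<le> real n powr (90 * y)"
proof -
  define w where "w = W powr (1/4)"
  have w: "1 \<le> w" using W by (simp add: w_def ge_one_powr_ge_zero)
  have W_eq: "W = w ^ 4" using W by (simp add: w_def powr_power)
  have "1 \<le> sqrt (real n)" using n by simp
  hence wy: "w \<le> y" using w by (simp add: y w_def[symmetric] mult_le_cancel_left1)
  have pow_n: "(2::real) powr a \<le> real n powr a" if "0 \<le> a" for a
    using that n by (intro powr_mono2) auto
  have "W = w powr 4" using w by (simp add: W_eq powr_numeral)
  also have "\<dots> \<le> (2 powr (2 * w)) powr 4" using w le_two_powr[of w] by (intro powr_mono2) auto
  also have "\<dots> = 2 powr (8 * w)" by (simp add: powr_powr)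
  also have "\<dots> \<le> real n powr (8 * w)" using w by (intro pow_n) auto
  also have "\<dots> \<le> real n powr (8 * y)" using wy n by (intro powr_mono) auto
  finally have "W\<^sup>2 \<le> (real n powr (8 * y))\<^sup>2" using W by (intro power_mono) auto
  moreover have "(real n powr (8 * y))\<^sup>2 = real n powr (16 * y)"
    by (simp add: power2_eq_square powr_add[symmetric])
  ultimately have W2: "W\<^sup>2 \<le> real n powr (16 * y)" by linarith
  have "real (3 * n) \<le> real n ^ 3"
  proof -
    have "3 \<le> real n ^ 2" using n power_mono[of 2 "real n" 2] by simp
    hence "3 * real n \<le> real n ^ 2 * real n" by (intro mult_right_mono) auto
    thus ?thesis by (simp add: power2_eq_square power3_eq_cube)
  qed
  hence "real (3 * n) ^ (4 * m) \<le> (real n ^ 3) ^ (4 * m)" by (intro power_mono) auto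
  also have "\<dots> = real n ^ (12 * m)" by (simp flip: power_mult)
  also have "\<dots> = real n powr real (12 * m)"
    by (rule powr_realpow[symmetric]) (use n in simp)
  also have "\<dots> \<le> real n powr (60 * y)"
    using n m w wy by (intro powr_mono) auto
  finally have n4m: "real (3 * n) ^ (4 * m) \<le> real n powr (60 * y)" .
  have "768 \<le> (2::real) powr 10" by (simp add: powr_numeral)
  also have "\<dots> \<le> real n powr 10" by (intro pow_n) auto
  finally have c: "768 \<le> real n powr 10" .
  have "3 * (real n)\<^sup>2 * (16 * W * real (3 * n) ^ (2 * m))\<^sup>2
      = 768 * (real n)\<^sup>2 * (W\<^sup>2 * real (3 * n) ^ (4 * m))"
    by (simp add: power_mult_distrib power_mult[symmetric] mult_ac)
  also have "\<dots> \<le> real n powr 10 * real n powr 2 * (real n powr (16 * y) * real n powr (60 * y))"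
    using c W2 n4m n by (intro mult_mono) (auto simp: powr_numeral)
  also have "\<dots> = real n powr (12 + 76 * y)" by (simp flip: powr_add del: powr_numeral)
  also have "\<dots> \<le> real n powr (90 * y)" using n w wy by (intro powr_mono) auto
  finally show ?thesis .
qed

lemma (in strategy_iteration) stops_within_discount:
  assumes "1 / (1 - lam) \<le> X"
  shows "\<exists>k. real k \<le> 3 * (real n)\<^sup>2 * X\<^sup>2 \<and> SI_stops_at V1 \<sigma> k"
proof -
  define L where "L = nat \<lceil>X\<^sup>2\<rceil>"
  have "1 \<le> 1 / (1 - lam)" using lam_nonneg lam_less_1 by simp
  hence X: "1 \<le> X\<^sup>2" using assms by (simp add: one_le_power)
  have "real L = real_of_int \<lceil>X\<^sup>2\<rceil>" using X by (simp add: L_def)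
  hence L: "X\<^sup>2 \<le> real L" "real L \<le> X\<^sup>2 + 1" by linarith+
  obtain k where k: "k \<le> n * n * L + 1" "SI_stops_at V1 \<sigma> k"
    using stops_within[OF power_less_gap[OF lam_nonneg lam_less_1 assms L(1)]] by blast
  have "real k \<le> real (n * n * L + 1)" using k(1) by (simp only: of_nat_le_iff)
  also have "\<dots> = (real n)\<^sup>2 * real L + 1" by (simp add: power2_eq_square)
  also have "\<dots> \<le> (real n)\<^sup>2 * (2 * X\<^sup>2) + (real n)\<^sup>2 * X\<^sup>2"
  proof (rule add_mono)
    show "(real n)\<^sup>2 * real L \<le> (real n)\<^sup>2 * (2 * X\<^sup>2)" using L X by (intro mult_left_mono) auto
    have "1 * 1 \<le> (real n)\<^sup>2 * X\<^sup>2" using n_pos X by (intro mult_mono) auto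
    thus "1 \<le> (real n)\<^sup>2 * X\<^sup>2" by simp
  qed
  finally have "real k \<le> 3 * (real n)\<^sup>2 * X\<^sup>2" by (simp add: mult_ac)
  thus ?thesis using k(2) by blast
qed

lemma (in strategy_iteration) stops_within_subexponential:
  assumes n: "2 \<le> n" and W: "1 \<le> max_reward"
  shows "\<exists>k. real k \<le> real n powr (90 * max_reward powr (1/4) * sqrt (real n)) \<and> SI_stops_at V1 \<sigma> k"
proof -
  define y where "y = max_reward powr (1/4) * sqrt (real n)"
  have "1 * 1 \<le> y" unfolding y_def using n W by (intro mult_mono) (auto simp: ge_one_powr_ge_zero)
  hence y: "1 \<le> y" by simp
  \<comment> \<open>The requirement is 144 y^4 \<le> m^4, and 4 is the least integer whose fourth
    power exceeds 144.\<close>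
  define m where "m = nat \<lceil>4 * y\<rceil>"
  have m: "4 * y \<le> real m" "real m \<le> 4 * y + 1" "0 < m" unfolding m_def using y by linarith+
  have "y ^ 4 = max_reward * (real n)\<^sup>2"
  proof -
    have "(max_reward powr (1/4)) ^ 4 = max_reward" using W by (simp add: powr_power)
    moreover have "sqrt (real n) ^ 4 = (real n)\<^sup>2"
      using power_mult[of "sqrt (real n)" 2 2] by simp
    ultimately show ?thesis by (simp add: y_def power_mult_distrib)
  qed
  moreover have "(4 * y) ^ 4 \<le> real m ^ 4" using m(1) y by (intro power_mono) auto
  moreover have "0 \<le> max_reward * (real n)\<^sup>2" using W by simp
  ultimately have m4: "16 * max_reward * (real (3 * n))\<^sup>2 \<le> real m ^ 4"
    by (simp add: power_mult_distrib)
  \<comment> \<open>Twice the constant in \<open>near_one\<close>, so that at distance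
    \<open>1 / X\<close> from 1 the product there is 1/2 and the strict inequality holds.\<close>
  define X where "X = 16 * max_reward * real (3 * n) ^ (2 * m)"
  have "1 * 1 \<le> max_reward * real (3 * n) ^ (2 * m)"
    using n W by (intro mult_mono one_le_power) auto
  hence X: "16 \<le> X" by (simp add: X_def)
  have "\<exists>k. real k \<le> 3 * (real n)\<^sup>2 * X\<^sup>2 \<and> SI_stops_at V1 \<sigma> k"
  proof (cases "1 / (1 - lam) \<le> X")
    case True
    thus ?thesis by (rule stops_within_discount)
  next
    case False
    define lam' where "lam' = 1 - 1 / X"
    have lam': "0 < lam'" "lam' < 1" "1 / (1 - lam') = X" using X by (auto simp: lam'_def field_simps)
    have small: "8 * max_reward * real (3 * n) ^ (2 * m) * z < 1" if "z \<le> 1 / X" for z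
    proof -
      have "8 * max_reward * real (3 * n) ^ (2 * m) * z = X * z / 2" by (simp add: X_def)
      moreover have "X * z \<le> 1" using that X by (simp add: pos_le_divide_eq mult.commute)
      ultimately show ?thesis by linarith
    qed
    have "1 - lam < 1 / X"
      using False X lam_less_1 by (simp add: not_le pos_less_divide_eq mult.commute)
    hence gap: "1 - lam \<le> 1 / X" "lam' < lam" by (simp_all add: lam'_def)
    have near: "near_one n max_reward m lam"
      unfolding near_one_def using lam'(1) gap lam_less_1 by (intro conjI small) linarith+
    have near': "near_one n max_reward m lam'"
      unfolding near_one_def using lam'(1,2) by (intro conjI small) (simp_all add: lam'_def)
    interpret near: strategy_iteration n V1 E r lam' \<sigma> \<tau>
      using n_pos game lam' SI_run_near_one[OF m(3) m4 near near'] by unfold_locales auto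
    show ?thesis using near.stops_within_discount[of X] lam'(3) by simp
  qed
  then obtain k where k: "real k \<le> 3 * (real n)\<^sup>2 * X\<^sup>2" "SI_stops_at V1 \<sigma> k" by blast
  have "real k \<le> real n powr (90 * y)"
    using k(1) iteration_bound[OF n W y_def m(2)] unfolding X_def by linarith
  thus ?thesis using k(2) unfolding y_def mult.assoc by blast
qed

lemma (in strategy_iteration) stops_if_one_vertex:
  assumes "n = 1"
  shows "SI_stops_at V1 \<sigma> 0"
proof -
  have "\<sigma> k v = 0" if "v \<in> V1" for k v
    using that \<sigma>_strat[of k] edge_less[of v "\<sigma> k v"] assms by (auto simp: strat1_def)
  thus ?thesis by (simp add: SI_stops_at_def)
qed

text \<open>The claimed bound is then \<open>n powr 0\<close>, that is 1. Index 0 would not do: the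
  initial strategy may differ from the least choice among tied edges.\<close>

lemma (in strategy_iteration) stops_if_zero_rewards:
  assumes "max_reward = 0"
  shows "SI_stops_at V1 \<sigma> 1"
proof -
  have "payoff r lam (move k) v = 0" if "v < n" for k v
    using edge_map_reward[OF edge_map_move[of k] that] assms unfolding payoff_def by simp
  thus ?thesis using stops_if_stationary[of 0] by (simp add: value_at_payoff)
qed

theorem theorem3p2:
  "\<exists>C::real. \<forall>(n::nat) V1 E r (lam::real) \<sigma> \<tau>.
     0 < n \<longrightarrow> game n V1 E \<longrightarrow> 0 \<le> lam \<longrightarrow> lam < 1 \<longrightarrow> SI_run n V1 E r lam \<sigma> \<tau> \<longrightarrow>
     (\<exists>k. real k \<le> real n powr (C * maxabs_reward E r powr (1/4) * sqrt (real n))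
          \<and> SI_stops_at V1 \<sigma> k) \<and>
     (\<forall>k. SI_stops_at V1 \<sigma> k \<longrightarrow> optimal1 n V1 E r lam (\<sigma> k))"
proof (rule exI[of _ 90], intro allI impI)
  fix n :: nat and V1 E r and lam :: real and \<sigma> \<tau>
  assume "0 < n" "game n V1 E" "0 \<le> lam" "lam < 1" "SI_run n V1 E r lam \<sigma> \<tau>"
  then interpret strategy_iteration n V1 E r lam \<sigma> \<tau> by unfold_locales
  obtain v u where e: "(v, u) \<in> E" using game n_pos by (auto simp: game_def)
  obtain M :: int where M: "max_reward = real_of_int M"
    by (simp add: max_reward_def maxabs_reward_def)
  have "0 \<le> max_reward" using reward_bound[OF e] by linarith
  \<comment> \<open>Integrality leaves no maximal reward strictly between 0 and 1, where the
    estimates would fail to apply.\<close>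
  hence "M = 0 \<or> 1 \<le> M" unfolding M by linarith
  hence W: "max_reward = 0 \<or> 1 \<le> max_reward" unfolding M by auto
  consider "n = 1" | "2 \<le> n" "max_reward = 0" | "2 \<le> n" "1 \<le> max_reward"
    using W n_pos by linarith
  hence "\<exists>k. real k \<le> real n powr (90 * max_reward powr (1/4) * sqrt (real n)) \<and> SI_stops_at V1 \<sigma> k"
  proof cases
    case 1
    thus ?thesis using stops_if_one_vertex by (intro exI[of _ 0]) simp
  next
    case 2
    thus ?thesis using stops_if_zero_rewards by (intro exI[of _ 1]) simp
  next
    case 3
    thus ?thesis by (rule stops_within_subexponential)
  qed
  thus "(\<exists>k. real k \<le> real n powr (90 * maxabs_reward E r powr (1/4) * sqrt (real n))
          \<and> SI_stops_at V1 \<sigma> k) \<and>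
     (\<forall>k. SI_stops_at V1 \<sigma> k \<longrightarrow> optimal1 n V1 E r lam (\<sigma> k))"
    using stops_imp_optimal by (simp add: max_reward_def)
qed

end
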